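(* For any $\mathcal{C}^2$ first-order standpoint logic formula $\phi$, one can compute in polynomial time a constant-free $\mathcal{C}^2$ first-order standpoint logic formula $\mathsf{CF}(\phi)$ equisatisfiable with $\phi$. If $\phi$ is S5 and nullary-free, then so is $\mathsf{CF}(\phi)$.
   Context: FOSL: signature $\langle\mathbf{P},\mathbf{C},\mathbf{S}\rangle$ (predicates with arities, constants $\mathbf{C}$, standpoint symbols including $*$). Terms are variables and constants. Standpoint expressions $e ::= s\mid e_1\cap e_2\mid e_1\cup e_2\mid e_1\setminus e_2$. Formulae $\phi ::= P(t_1,\dots,t_k)\mid t_1\doteq t_2\mid\neg\phi\mid\phi\wedge\psi\mid\exists^{\lhd n}x.\phi\mid\Diamond_e\phi$. Standpoint structure $\langle\Delta,\Pi,\sigma,\gamma\rangle$: nonempty domain, nonempty precisification set $\Pi$, $\sigma( * )=\Pi$ extended set-theoretically, $\gamma(\pi)$ a first-order structure over $\Delta$, each constant being interpreted by the same element in every precisification; $\Diamond_e\phi$ holds at $\pi$ iff $\phi$ holds at some $\pi'\in\sigma(e)$ under the same assignment; a model satisfies the formula at every precisification under every assignment. Equisatisfiable: one satisfiable iff the other is. $\mathcal{C}^2$: only variables $x,y$ and predicates of arity at most 2. Constant-free: no constants. S5: only standpoint expression $*$. Nullary-free: no $0$-ary predicates. *)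

theory Defs
  imports "HOL-Computational_Algebra.Polynomial" "HOL-Library.Countable_Set"
begin

section \<open>First-order standpoint logic with counting\<close>

datatype trm = Var nat | Const nat

datatype standpoint = Star | Standpoint nat

datatype sexpr =
    ESym standpoint
  | EInter sexpr sexpr
  | EUnion sexpr sexpr
  | EDiff sexpr sexpr

datatype comparison = AtMost | Exactly | AtLeast

text \<open>
  The vocabulary consists of all possible names, and every formula uses finitely many of them.
  A predicate symbol is a pair of a name and an arity.  In an atom the arity is the number of
  arguments, so \<open>Pred p ts\<close> is the predicate symbol \<open>(p, length ts)\<close> applied to \<open>ts\<close>, and
  every term of type \<open>fm\<close> respects the arities.
\<close>

datatype fm =
    Pred nat "trm list"
  | Eq trm trm
  | Neg fm
  | Conj fm fm
  | Exists comparison nat nat fm  \<comment> \<open>\<open>Exists cmp n x \<phi>\<close>: the number of \<open>x\<close> with \<open>\<phi>\<close> is \<open>cmp\<close> \<open>n\<close>\<close>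
  | Dia sexpr fm

record 'd fo_structure =
  const_int :: "nat \<Rightarrow> 'd"
  pred_int :: "nat \<Rightarrow> nat \<Rightarrow> 'd list set"  \<comment> \<open>name, arity\<close>

record ('d, 'p) standpoint_structure =
  domain :: "'d set"
  precs :: "'p set"
  sigma :: "standpoint \<Rightarrow> 'p set"
  gamma :: "'p \<Rightarrow> 'd fo_structure"

definition fo_structure_over :: "'d set \<Rightarrow> 'd fo_structure \<Rightarrow> bool" where
  "fo_structure_over D I \<longleftrightarrow>
     (\<forall>c. const_int I c \<in> D) \<and>
     (\<forall>p k. pred_int I p k \<subseteq> {ds. length ds = k \<and> set ds \<subseteq> D})"

definition standpoint_structure :: "('d, 'p) standpoint_structure \<Rightarrow> bool" where
  "standpoint_structure M \<longleftrightarrow>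
     domain M \<noteq> {} \<and> precs M \<noteq> {} \<and>
     (\<forall>s. sigma M s \<subseteq> precs M) \<and> sigma M Star = precs M \<and>
     (\<forall>\<pi>\<in>precs M. fo_structure_over (domain M) (gamma M \<pi>)) \<and>
     (\<forall>\<pi>\<in>precs M. \<forall>\<pi>'\<in>precs M. \<forall>c. const_int (gamma M \<pi>) c = const_int (gamma M \<pi>') c)"

fun sexpr_int :: "(standpoint \<Rightarrow> 'p set) \<Rightarrow> sexpr \<Rightarrow> 'p set" where
  "sexpr_int \<sigma> (ESym s) = \<sigma> s"
| "sexpr_int \<sigma> (EInter e f) = sexpr_int \<sigma> e \<inter> sexpr_int \<sigma> f"
| "sexpr_int \<sigma> (EUnion e f) = sexpr_int \<sigma> e \<union> sexpr_int \<sigma> f"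
| "sexpr_int \<sigma> (EDiff e f) = sexpr_int \<sigma> e - sexpr_int \<sigma> f"

fun trm_int :: "'d fo_structure \<Rightarrow> (nat \<Rightarrow> 'd) \<Rightarrow> trm \<Rightarrow> 'd" where
  "trm_int I v (Var x) = v x"
| "trm_int I v (Const c) = const_int I c"

fun compares :: "comparison \<Rightarrow> nat \<Rightarrow> 'd set \<Rightarrow> bool" where
  "compares AtMost n W \<longleftrightarrow> finite W \<and> card W \<le> n"
| "compares Exactly n W \<longleftrightarrow> finite W \<and> card W = n"
| "compares AtLeast n W \<longleftrightarrow> infinite W \<or> card W \<ge> n"

fun sat :: "('d, 'p) standpoint_structure \<Rightarrow> 'p \<Rightarrow> (nat \<Rightarrow> 'd) \<Rightarrow> fm \<Rightarrow> bool" where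
  "sat M \<pi> v (Pred p ts) \<longleftrightarrow>
     map (trm_int (gamma M \<pi>) v) ts \<in> pred_int (gamma M \<pi>) p (length ts)"
| "sat M \<pi> v (Eq t u) \<longleftrightarrow> trm_int (gamma M \<pi>) v t = trm_int (gamma M \<pi>) v u"
| "sat M \<pi> v (Neg \<phi>) \<longleftrightarrow> \<not> sat M \<pi> v \<phi>"
| "sat M \<pi> v (Conj \<phi> \<psi>) \<longleftrightarrow> sat M \<pi> v \<phi> \<and> sat M \<pi> v \<psi>"
| "sat M \<pi> v (Exists cmp n x \<phi>) \<longleftrightarrow> compares cmp n {d \<in> domain M. sat M \<pi> (v(x := d)) \<phi>}"
| "sat M \<pi> v (Dia e \<phi>) \<longleftrightarrow> (\<exists>\<pi>'\<in>sexpr_int (sigma M) e. sat M \<pi>' v \<phi>)"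

definition models :: "('d, 'p) standpoint_structure \<Rightarrow> fm \<Rightarrow> bool" where
  "models M \<phi> \<longleftrightarrow> standpoint_structure M \<and>
     (\<forall>\<pi>\<in>precs M. \<forall>v. range v \<subseteq> domain M \<longrightarrow> sat M \<pi> v \<phi>)"

text \<open>
  A HOL definition cannot quantify over types, so domains and precisification sets are taken to
  be sets of natural numbers.  The theorem \<open>models_imp_satisfiable\<close> below
  (downward Loewenheim-Skolem) shows that models over arbitrary types yield the same notion.
\<close>

definition satisfiable :: "fm \<Rightarrow> bool" where
  "satisfiable \<phi> \<longleftrightarrow> (\<exists>M :: (nat, nat) standpoint_structure. models M \<phi>)"

definition equisatisfiable :: "fm \<Rightarrow> fm \<Rightarrow> bool" where
  "equisatisfiable \<phi> \<psi> \<longleftrightarrow> (satisfiable \<phi> \<longleftrightarrow> satisfiable \<psi>)"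


section \<open>Syntactic fragments\<close>

fun trm_vars :: "trm \<Rightarrow> nat set" where
  "trm_vars (Var x) = {x}"
| "trm_vars (Const c) = {}"

fun trm_consts :: "trm \<Rightarrow> nat set" where
  "trm_consts (Var x) = {}"
| "trm_consts (Const c) = {c}"

fun fm_vars :: "fm \<Rightarrow> nat set" where
  "fm_vars (Pred p ts) = (\<Union>t\<in>set ts. trm_vars t)"
| "fm_vars (Eq t u) = trm_vars t \<union> trm_vars u"
| "fm_vars (Neg \<phi>) = fm_vars \<phi>"
| "fm_vars (Conj \<phi> \<psi>) = fm_vars \<phi> \<union> fm_vars \<psi>"
| "fm_vars (Exists cmp n x \<phi>) = insert x (fm_vars \<phi>)"
| "fm_vars (Dia e \<phi>) = fm_vars \<phi>"

fun fm_consts :: "fm \<Rightarrow> nat set" where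
  "fm_consts (Pred p ts) = (\<Union>t\<in>set ts. trm_consts t)"
| "fm_consts (Eq t u) = trm_consts t \<union> trm_consts u"
| "fm_consts (Neg \<phi>) = fm_consts \<phi>"
| "fm_consts (Conj \<phi> \<psi>) = fm_consts \<phi> \<union> fm_consts \<psi>"
| "fm_consts (Exists cmp n x \<phi>) = fm_consts \<phi>"
| "fm_consts (Dia e \<phi>) = fm_consts \<phi>"

fun fm_preds :: "fm \<Rightarrow> (nat \<times> nat) set" where  \<comment> \<open>name, arity\<close>
  "fm_preds (Pred p ts) = {(p, length ts)}"
| "fm_preds (Eq t u) = {}"
| "fm_preds (Neg \<phi>) = fm_preds \<phi>"
| "fm_preds (Conj \<phi> \<psi>) = fm_preds \<phi> \<union> fm_preds \<psi>"
| "fm_preds (Exists cmp n x \<phi>) = fm_preds \<phi>"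
| "fm_preds (Dia e \<phi>) = fm_preds \<phi>"

fun fm_sexprs :: "fm \<Rightarrow> sexpr set" where
  "fm_sexprs (Pred p ts) = {}"
| "fm_sexprs (Eq t u) = {}"
| "fm_sexprs (Neg \<phi>) = fm_sexprs \<phi>"
| "fm_sexprs (Conj \<phi> \<psi>) = fm_sexprs \<phi> \<union> fm_sexprs \<psi>"
| "fm_sexprs (Exists cmp n x \<phi>) = fm_sexprs \<phi>"
| "fm_sexprs (Dia e \<phi>) = insert e (fm_sexprs \<phi>)"

text \<open>The two variables \<open>x\<close> and \<open>y\<close> of the two-variable fragment are \<open>0\<close> and \<open>1\<close>.\<close>

definition C2 :: "fm \<Rightarrow> bool" where
  "C2 \<phi> \<longleftrightarrow> fm_vars \<phi> \<subseteq> {0, 1} \<and> (\<forall>(p, k)\<in>fm_preds \<phi>. k \<le> 2)"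

definition constant_free :: "fm \<Rightarrow> bool" where
  "constant_free \<phi> \<longleftrightarrow> fm_consts \<phi> = {}"

definition S5 :: "fm \<Rightarrow> bool" where
  "S5 \<phi> \<longleftrightarrow> fm_sexprs \<phi> \<subseteq> {ESym Star}"

definition nullary_free :: "fm \<Rightarrow> bool" where
  "nullary_free \<phi> \<longleftrightarrow> (\<forall>(p, k)\<in>fm_preds \<phi>. k \<noteq> 0)"


section \<open>Polynomial-time computability\<close>

subsection \<open>Deterministic multitape Turing machines\<close>

datatype 'a symbol = Blank | Letter 'a | Work nat

datatype direction = MoveLeft | Stay | MoveRight

record 'a tm =
  tapes :: nat
  states :: "nat set"
  start :: nat
  halt :: nat
  alphabet :: "'a symbol set"
  delta :: "nat \<Rightarrow> 'a symbol list \<Rightarrow> nat \<times> ('a symbol \<times> direction) list"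

definition turing_machine :: "'a tm \<Rightarrow> bool" where
  "turing_machine T \<longleftrightarrow>
     tapes T \<ge> 1 \<and> finite (states T) \<and> start T \<in> states T \<and> halt T \<in> states T \<and>
     finite (alphabet T) \<and> Blank \<in> alphabet T \<and> range Letter \<subseteq> alphabet T \<and>
     (\<forall>q\<in>states T. \<forall>as. length as = tapes T \<and> set as \<subseteq> alphabet T \<longrightarrow>
        (case delta T q as of (q', acts) \<Rightarrow>
           q' \<in> states T \<and> length acts = tapes T \<and> fst ` set acts \<subseteq> alphabet T))"

type_synonym 'a tape = "(int \<Rightarrow> 'a symbol) \<times> int"  \<comment> \<open>contents and head position\<close>

fun read :: "'a tape \<Rightarrow> 'a symbol" where
  "read (f, i) = f i"

fun shift :: "direction \<Rightarrow> int \<Rightarrow> int" where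
  "shift MoveLeft i = i - 1"
| "shift Stay i = i"
| "shift MoveRight i = i + 1"

fun act :: "'a symbol \<times> direction \<Rightarrow> 'a tape \<Rightarrow> 'a tape" where
  "act (a, d) (f, i) = (f(i := a), shift d i)"

fun step :: "'a tm \<Rightarrow> nat \<times> 'a tape list \<Rightarrow> nat \<times> 'a tape list" where
  "step T (q, ts) =
     (if q = halt T then (q, ts)
      else case delta T q (map read ts) of (q', acts) \<Rightarrow> (q', map2 act acts ts))"

definition written :: "'a list \<Rightarrow> int \<Rightarrow> 'a symbol" where
  "written w i = (if 0 \<le> i \<and> i < int (length w) then Letter (w ! nat i) else Blank)"

text \<open>The input is on the first tape, the output on the last one (the same one if there is one tape).\<close>

definition initial :: "'a tm \<Rightarrow> 'a list \<Rightarrow> nat \<times> 'a tape list" where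
  "initial T w = (start T, (written w, 0) # replicate (tapes T - 1) (written [], 0))"

definition outputs_within :: "'a tm \<Rightarrow> nat \<Rightarrow> 'a list \<Rightarrow> 'a list \<Rightarrow> bool" where
  "outputs_within T n w u \<longleftrightarrow>
     (case (step T ^^ n) (initial T w) of (q, ts) \<Rightarrow> q = halt T \<and> fst (last ts) = written u)"

definition polytime_on :: "('x \<Rightarrow> 'a list) \<Rightarrow> 'x set \<Rightarrow> ('x \<Rightarrow> 'x) \<Rightarrow> bool" where
  "polytime_on enc X f \<longleftrightarrow>
     (\<exists>(T :: 'a tm) (b :: nat poly). turing_machine T \<and>
        (\<forall>x\<in>X. outputs_within T (poly b (length (enc x))) (enc x) (enc (f x))))"


subsection \<open>Formulae as words\<close>

text \<open>
  Formulae are written in prefix notation over a finite alphabet; names and the numbers in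
  counting quantifiers are written in binary, least significant bit first.
\<close>

datatype letter =
    Bit0 | Bit1 | Stop
  | LVar | LConst | LPred | LEq | LNeg | LConj
  | LAtMost | LExactly | LAtLeast
  | LDia | LStar | LStandpoint | LInter | LUnion | LDiff

fun bits :: "nat \<Rightarrow> letter list" where
  "bits n = (if n = 0 then [] else (if even n then Bit0 else Bit1) # bits (n div 2))"

declare bits.simps [simp del]

definition encode_nat :: "nat \<Rightarrow> letter list" where
  "encode_nat n = bits n @ [Stop]"

fun encode_trm :: "trm \<Rightarrow> letter list" where
  "encode_trm (Var x) = LVar # encode_nat x"
| "encode_trm (Const c) = LConst # encode_nat c"

fun encode_sexpr :: "sexpr \<Rightarrow> letter list" where
  "encode_sexpr (ESym Star) = [LStar]"
| "encode_sexpr (ESym (Standpoint s)) = LStandpoint # encode_nat s"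
| "encode_sexpr (EInter e f) = LInter # encode_sexpr e @ encode_sexpr f"
| "encode_sexpr (EUnion e f) = LUnion # encode_sexpr e @ encode_sexpr f"
| "encode_sexpr (EDiff e f) = LDiff # encode_sexpr e @ encode_sexpr f"

fun encode_comparison :: "comparison \<Rightarrow> letter" where
  "encode_comparison AtMost = LAtMost"
| "encode_comparison Exactly = LExactly"
| "encode_comparison AtLeast = LAtLeast"

fun encode_fm :: "fm \<Rightarrow> letter list" where
  "encode_fm (Pred p ts) = LPred # encode_nat p @ concat (map encode_trm ts) @ [Stop]"
| "encode_fm (Eq t u) = LEq # encode_trm t @ encode_trm u"
| "encode_fm (Neg \<phi>) = LNeg # encode_fm \<phi>"
| "encode_fm (Conj \<phi> \<psi>) = LConj # encode_fm \<phi> @ encode_fm \<psi>"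
| "encode_fm (Exists cmp n x \<phi>) =
     encode_comparison cmp # encode_nat n @ encode_nat x @ encode_fm \<phi>"
| "encode_fm (Dia e \<phi>) = LDia # encode_sexpr e @ encode_fm \<phi>"


section \<open>The encoding is injective\<close>

lemma bits_inject:
  "bits m @ Stop # r = bits n @ Stop # s \<longleftrightarrow> m = n \<and> r = s"
proof (induction m arbitrary: n rule: less_induct)
  case (less m)
  show ?case
  proof (cases "m = 0 \<or> n = 0")
    case True
    then show ?thesis by (auto simp: bits.simps[of m] bits.simps[of n])
  next
    case False
    then have "m div 2 < m" by simp
    note IH = less.IH[OF this, of "n div 2"]
    have "m = n \<longleftrightarrow> even m = even n \<and> m div 2 = n div 2"
      by presburger
    with False IH show ?thesis
      by (auto simp: bits.simps[of m] bits.simps[of n])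
  qed
qed

lemma encode_nat_inject: "encode_nat m @ r = encode_nat n @ s \<longleftrightarrow> m = n \<and> r = s"
  by (simp add: encode_nat_def bits_inject)

lemma encode_trm_inject: "encode_trm t @ r = encode_trm u @ s \<longleftrightarrow> t = u \<and> r = s"
  by (cases t; cases u) (auto simp: encode_nat_inject)

lemma encode_trm_neq_Stop: "encode_trm t @ r \<noteq> Stop # s"
  by (cases t) auto

lemma encode_trms_inject:
  "concat (map encode_trm ts) @ Stop # r = concat (map encode_trm us) @ Stop # s
     \<longleftrightarrow> ts = us \<and> r = s"
proof (induction ts arbitrary: us)
  case Nil
  then show ?case by (cases us) (auto simp: encode_trm_neq_Stop[symmetric])
next
  case (Cons t ts)
  then show ?case by (cases us) (auto simp: encode_trm_neq_Stop encode_trm_inject)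
qed

lemma encode_sexpr_inject: "encode_sexpr e @ r = encode_sexpr f @ s \<longleftrightarrow> e = f \<and> r = s"
proof (induction e arbitrary: f r s rule: encode_sexpr.induct)
  case 1
  then show ?case by (cases f rule: encode_sexpr.cases) auto
next
  case (2 x)
  then show ?case by (cases f rule: encode_sexpr.cases) (auto simp: encode_nat_inject)
next
  case (3 e1 e2)
  then show ?case by (cases f rule: encode_sexpr.cases) auto
next
  case (4 e1 e2)
  then show ?case by (cases f rule: encode_sexpr.cases) auto
next
  case (5 e1 e2)
  then show ?case by (cases f rule: encode_sexpr.cases) auto
qed

lemma encode_comparison_inject: "encode_comparison c = encode_comparison d \<longleftrightarrow> c = d"
  by (cases c; cases d) auto

lemma encode_comparison_neq [simp]:
  "encode_comparison c \<noteq> LPred" "LPred \<noteq> encode_comparison c"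
  "encode_comparison c \<noteq> LEq" "LEq \<noteq> encode_comparison c"
  "encode_comparison c \<noteq> LNeg" "LNeg \<noteq> encode_comparison c"
  "encode_comparison c \<noteq> LConj" "LConj \<noteq> encode_comparison c"
  "encode_comparison c \<noteq> LDia" "LDia \<noteq> encode_comparison c"
  by (cases c; simp)+

lemma encode_fm_prefix_inject: "encode_fm \<phi> @ r = encode_fm \<psi> @ s \<longleftrightarrow> \<phi> = \<psi> \<and> r = s"
proof (induction \<phi> arbitrary: \<psi> r s)
  case (Pred p ts)
  then show ?case
    by (cases \<psi>) (auto simp: encode_nat_inject encode_trms_inject)
next
  case (Eq t u)
  then show ?case
    by (cases \<psi>) (auto simp: encode_trm_inject)
next
  case (Neg \<phi>)
  then show ?case by (cases \<psi>) auto
next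
  case (Conj \<phi>1 \<phi>2)
  then show ?case by (cases \<psi>) auto
next
  case (Exists c n x \<phi>)
  then show ?case
    by (cases \<psi>) (auto simp: encode_nat_inject encode_comparison_inject)
next
  case (Dia e \<phi>)
  then show ?case
    by (cases \<psi>) (auto simp: encode_sexpr_inject)
qed

theorem inj_encode_fm: "inj encode_fm"
  using encode_fm_prefix_inject[where r = "[]" and s = "[]"] by (auto intro: injI)


section \<open>Satisfiability does not depend on the underlying types\<close>

lemma trm_int_cong: "(\<And>x. x \<in> trm_vars t \<Longrightarrow> v x = w x) \<Longrightarrow> trm_int I v t = trm_int I w t"
  by (cases t) auto

lemma sat_cong: "(\<And>x. x \<in> fm_vars \<phi> \<Longrightarrow> v x = w x) \<Longrightarrow> sat M \<pi> v \<phi> = sat M \<pi> w \<phi>"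
proof (induction \<phi> arbitrary: \<pi> v w)
  case (Pred p ts)
  then have "map (trm_int (gamma M \<pi>) v) ts = map (trm_int (gamma M \<pi>) w) ts"
    by (auto intro!: trm_int_cong)
  then show ?case by (simp del: map_eq_conv)
next
  case (Eq t u)
  have "trm_int (gamma M \<pi>) v t = trm_int (gamma M \<pi>) w t"
    "trm_int (gamma M \<pi>) v u = trm_int (gamma M \<pi>) w u"
    using Eq.prems by (auto intro!: trm_int_cong)
  then show ?case by simp
next
  case (Neg \<phi>)
  have "sat M \<pi> v \<phi> = sat M \<pi> w \<phi>"
    using Neg.prems by (auto intro!: Neg.IH)
  then show ?case by simp
next
  case (Conj \<phi> \<psi>)
  have "sat M \<pi> v \<phi> = sat M \<pi> w \<phi>" "sat M \<pi> v \<psi> = sat M \<pi> w \<psi>"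
    using Conj.prems by (auto intro!: Conj.IH)
  then show ?case by simp
next
  case (Exists cmp n x \<phi>)
  have "sat M \<pi> (v(x := d)) \<phi> = sat M \<pi> (w(x := d)) \<phi>" for d
    using Exists.prems by (auto intro!: Exists.IH)
  then show ?case by simp
next
  case (Dia e \<phi>)
  have "sat M \<pi>' v \<phi> = sat M \<pi>' w \<phi>" for \<pi>'
    using Dia.prems by (auto intro!: Dia.IH)
  then show ?case by simp
qed

lemma finite_fm_vars: "finite (fm_vars \<phi>)"
proof (induction \<phi>)
  case (Pred p ts)
  have "finite (trm_vars t)" for t by (cases t) auto
  then show ?case by simp
next
  case (Eq t u)
  have "finite (trm_vars t)" for t by (cases t) auto
  then show ?case by simp
qed auto

lemma standpoint_structureD:
  assumes "standpoint_structure M"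
  shows "domain M \<noteq> {}" "precs M \<noteq> {}" "sigma M s \<subseteq> precs M" "sigma M Star = precs M"
    and "\<pi> \<in> precs M \<Longrightarrow> const_int (gamma M \<pi>) c \<in> domain M"
    and "\<pi> \<in> precs M \<Longrightarrow> pred_int (gamma M \<pi>) p k \<subseteq> {ds. length ds = k \<and> set ds \<subseteq> domain M}"
  using assms unfolding standpoint_structure_def fo_structure_over_def by blast+

lemma const_int_rigid:
  assumes "standpoint_structure M" "\<pi> \<in> precs M" "\<pi>' \<in> precs M"
  shows "const_int (gamma M \<pi>) c = const_int (gamma M \<pi>') c"
  using assms unfolding standpoint_structure_def by blast

lemma sexpr_int_subset:
  assumes "standpoint_structure M"
  shows "sexpr_int (sigma M) e \<subseteq> precs M"
  using standpoint_structureD(3)[OF assms] by (induction e) auto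

text \<open>Invariance under isomorphism.\<close>

definition transport ::
  "('d \<Rightarrow> 'e) \<Rightarrow> ('p \<Rightarrow> 'q) \<Rightarrow> ('d, 'p) standpoint_structure \<Rightarrow> ('e, 'q) standpoint_structure"
where
  "transport f g M =
     \<lparr>domain = f ` domain M, precs = g ` precs M, sigma = (\<lambda>s. g ` sigma M s),
      gamma = (\<lambda>\<rho>. let I = gamma M (inv_into (precs M) g \<rho>) in
         \<lparr>const_int = (\<lambda>c. f (const_int I c)), pred_int = (\<lambda>p k. map f ` pred_int I p k)\<rparr>)\<rparr>"

lemma compares_image:
  assumes "inj_on f W"
  shows "compares cmp n (f ` W) = compares cmp n W"
  using assms by (cases cmp) (auto simp: card_image finite_image_iff)

context
  fixes M :: "('d, 'p) standpoint_structure" and f :: "'d \<Rightarrow> 'e" and g :: "'p \<Rightarrow> 'q"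
  assumes M: "standpoint_structure M" and f: "inj_on f (domain M)" and g: "inj_on g (precs M)"
begin

lemma transport_simps:
  "domain (transport f g M) = f ` domain M"
  "precs (transport f g M) = g ` precs M"
  "sigma (transport f g M) s = g ` sigma M s"
  "\<pi> \<in> precs M \<Longrightarrow> const_int (gamma (transport f g M) (g \<pi>)) c = f (const_int (gamma M \<pi>) c)"
  "\<pi> \<in> precs M \<Longrightarrow> pred_int (gamma (transport f g M) (g \<pi>)) p k = map f ` pred_int (gamma M \<pi>) p k"
  using g by (simp_all add: transport_def Let_def)

lemma transport_structure: "standpoint_structure (transport f g M)"
  unfolding standpoint_structure_def
proof (intro conjI allI ballI)
  show "domain (transport f g M) \<noteq> {}" "precs (transport f g M) \<noteq> {}"
    using standpoint_structureD(1,2)[OF M] by (simp_all add: transport_simps)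
  show "sigma (transport f g M) s \<subseteq> precs (transport f g M)" for s
    using standpoint_structureD(3)[OF M] by (simp add: transport_simps image_mono)
  show "sigma (transport f g M) Star = precs (transport f g M)"
    using standpoint_structureD(4)[OF M] by (simp add: transport_simps)
next
  fix \<rho>
  assume "\<rho> \<in> precs (transport f g M)"
  then obtain \<pi> where \<pi>: "\<pi> \<in> precs M" "\<rho> = g \<pi>" by (auto simp: transport_simps)
  have "map f ` pred_int (gamma M \<pi>) p k \<subseteq> {ds. length ds = k \<and> set ds \<subseteq> f ` domain M}" for p k
    using standpoint_structureD(6)[OF M \<pi>(1), of p k] by fastforce
  then show "fo_structure_over (domain (transport f g M)) (gamma (transport f g M) \<rho>)"
    using \<pi> standpoint_structureD(5)[OF M \<pi>(1)]
    by (simp add: fo_structure_over_def transport_simps)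
next
  fix \<rho> \<rho>' c
  assume "\<rho> \<in> precs (transport f g M)" "\<rho>' \<in> precs (transport f g M)"
  then obtain \<pi> \<pi>' where "\<pi> \<in> precs M" "\<rho> = g \<pi>" "\<pi>' \<in> precs M" "\<rho>' = g \<pi>'"
    by (auto simp: transport_simps)
  then show "const_int (gamma (transport f g M) \<rho>) c = const_int (gamma (transport f g M) \<rho>') c"
    using const_int_rigid[OF M, of \<pi> \<pi>' c] by (simp add: transport_simps)
qed

lemma sexpr_int_transport:
  "sexpr_int (sigma (transport f g M)) e = g ` sexpr_int (sigma M) e"
proof (induction e)
  case (ESym s)
  then show ?case by (simp add: transport_def)
next
  case (EInter a b)
  then show ?case
    using inj_on_image_Int[OF g sexpr_int_subset[OF M, of a] sexpr_int_subset[OF M, of b]] by simp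
next
  case (EUnion a b)
  then show ?case by (simp add: image_Un)
next
  case (EDiff a b)
  have "sexpr_int (sigma M) a - sexpr_int (sigma M) b \<subseteq> precs M"
    using sexpr_int_subset[OF M, of a] by blast
  with EDiff show ?case
    using inj_on_image_set_diff[OF g _ sexpr_int_subset[OF M, of b]] by simp
qed

lemma trm_int_in_domain:
  assumes "\<pi> \<in> precs M" "range v \<subseteq> domain M"
  shows "trm_int (gamma M \<pi>) v t \<in> domain M"
  using assms standpoint_structureD(5)[OF M] by (cases t) auto

lemma trm_int_transport:
  assumes "\<pi> \<in> precs M"
  shows "trm_int (gamma (transport f g M) (g \<pi>)) (f \<circ> v) t = f (trm_int (gamma M \<pi>) v t)"
  using assms by (cases t) (simp_all add: transport_simps)

lemma sat_transport:
  assumes "\<pi> \<in> precs M" "range v \<subseteq> domain M"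
  shows "sat (transport f g M) (g \<pi>) (f \<circ> v) \<phi> = sat M \<pi> v \<phi>"
  using assms
proof (induction \<phi> arbitrary: \<pi> v)
  case (Pred p ts)
  let ?ds = "map (trm_int (gamma M \<pi>) v) ts"
  have "map (trm_int (gamma (transport f g M) (g \<pi>)) (f \<circ> v)) ts = map f ?ds"
    using trm_int_transport[OF Pred.prems(1), of v] by (simp only: map_map map_eq_conv comp_apply) simp
  moreover have "pred_int (gamma (transport f g M) (g \<pi>)) p (length ts)
      = map f ` pred_int (gamma M \<pi>) p (length ts)"
    by (rule transport_simps(5)[OF Pred.prems(1)])
  moreover have "inj_on (map f) (lists (domain M))"
    using f by (rule inj_on_map_lists)
  moreover have "?ds \<in> lists (domain M)"
    using trm_int_in_domain[OF Pred.prems] by (simp add: lists_eq_set image_subset_iff)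
  moreover have "pred_int (gamma M \<pi>) p (length ts) \<subseteq> lists (domain M)"
    using standpoint_structureD(6)[OF M Pred.prems(1), of p "length ts"] by blast
  ultimately show ?case
    by (simp only: sat.simps inj_on_image_mem_iff)
next
  case (Eq t u)
  then show ?case
    using trm_int_in_domain[OF Eq.prems] f
    by (simp only: sat.simps trm_int_transport[OF Eq.prems(1)] inj_on_eq_iff)
next
  case (Exists cmp n x \<phi>)
  have "sat (transport f g M) (g \<pi>) ((f \<circ> v)(x := f d)) \<phi> = sat M \<pi> (v(x := d)) \<phi>"
    if "d \<in> domain M" for d
  proof -
    have "range (v(x := d)) \<subseteq> domain M" using Exists.prems that by auto
    note IH = Exists.IH[OF Exists.prems(1) this]
    have "(f \<circ> v)(x := f d) = f \<circ> v(x := d)" by auto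
    then show ?thesis by (simp only: IH)
  qed
  then have "{d \<in> domain (transport f g M). sat (transport f g M) (g \<pi>) ((f \<circ> v)(x := d)) \<phi>}
      = f ` {d \<in> domain M. sat M \<pi> (v(x := d)) \<phi>}"
    by (auto simp: transport_def)
  moreover have "inj_on f {d \<in> domain M. sat M \<pi> (v(x := d)) \<phi>}"
    using f by (rule inj_on_subset) auto
  ultimately show ?case by (simp only: sat.simps compares_image)
next
  case (Dia e \<phi>)
  have "sat (transport f g M) (g \<pi>') (f \<circ> v) \<phi> = sat M \<pi>' v \<phi>"
    if "\<pi>' \<in> sexpr_int (sigma M) e" for \<pi>'
    using Dia sexpr_int_subset[OF M, of e] that by blast
  then show ?case unfolding sat.simps sexpr_int_transport by blast
next
  case (Neg \<phi>)
  then show ?case by (simp only: sat.simps)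
next
  case (Conj \<phi> \<psi>)
  then show ?case by (simp only: sat.simps)
qed

lemma models_transport:
  assumes "models M \<phi>"
  shows "models (transport f g M) \<phi>"
  unfolding models_def
proof (intro conjI ballI allI impI)
  show "standpoint_structure (transport f g M)" by (rule transport_structure)
next
  fix \<rho> and w :: "nat \<Rightarrow> 'e"
  assume "\<rho> \<in> precs (transport f g M)" and w: "range w \<subseteq> domain (transport f g M)"
  then obtain \<pi> where \<pi>: "\<pi> \<in> precs M" "\<rho> = g \<pi>" by (auto simp: transport_def)
  define v where "v = (\<lambda>x. inv_into (domain M) f (w x))"
  have wf: "w x \<in> f ` domain M" for x using w by (auto simp: transport_def)
  have "range v \<subseteq> domain M" using wf by (auto simp: v_def intro: inv_into_into)
  moreover have "w = f \<circ> v" using wf by (auto simp: v_def f_inv_into_f)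
  moreover have "sat M \<pi> v \<phi>"
    using assms \<pi>(1) \<open>range v \<subseteq> domain M\<close> unfolding models_def by blast
  ultimately show "sat (transport f g M) \<rho> w \<phi>"
    using \<pi> sat_transport[of \<pi> v \<phi>] by simp
qed

end

text \<open>Countable elementary substructures.\<close>

instance trm :: countable by countable_datatype
instance standpoint :: countable by countable_datatype
instance sexpr :: countable by countable_datatype
instance comparison :: countable by countable_datatype
instance fm :: countable by countable_datatype

definition restrict ::
  "'d set \<Rightarrow> 'p set \<Rightarrow> ('d, 'p) standpoint_structure \<Rightarrow> ('d, 'p) standpoint_structure"
where
  "restrict D Q M =
     \<lparr>domain = D, precs = Q, sigma = (\<lambda>s. sigma M s \<inter> Q),
      gamma = (\<lambda>\<pi>. \<lparr>const_int = const_int (gamma M \<pi>),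
                    pred_int = (\<lambda>p k. pred_int (gamma M \<pi>) p k \<inter> lists D)\<rparr>)\<rparr>"

lemma sexpr_int_restrict: "sexpr_int (sigma (restrict D Q M)) e = sexpr_int (sigma M) e \<inter> Q"
  by (induction e) (auto simp: restrict_def)

lemma restrict_simps:
  "domain (restrict D Q M) = D"
  "precs (restrict D Q M) = Q"
  "sigma (restrict D Q M) s = sigma M s \<inter> Q"
  "const_int (gamma (restrict D Q M) \<pi>) c = const_int (gamma M \<pi>) c"
  "pred_int (gamma (restrict D Q M) \<pi>) p k = pred_int (gamma M \<pi>) p k \<inter> lists D"
  by (simp_all add: restrict_def)

lemma restrict_structure:
  assumes M: "standpoint_structure M" and Q: "Q \<subseteq> precs M" and "D \<noteq> {}" "Q \<noteq> {}"
    and const: "\<And>\<pi> c. \<pi> \<in> Q \<Longrightarrow> const_int (gamma M \<pi>) c \<in> D"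
  shows "standpoint_structure (restrict D Q M)"
  unfolding standpoint_structure_def restrict_simps
proof (intro conjI allI ballI)
  show "sigma M Star \<inter> Q = Q" using standpoint_structureD(4)[OF M] Q by blast
next
  fix \<pi>
  assume \<pi>: "\<pi> \<in> Q"
  have "pred_int (gamma M \<pi>) p k \<inter> lists D \<subseteq> {ds. length ds = k \<and> set ds \<subseteq> D}" for p k
    using standpoint_structureD(6)[OF M, of \<pi> p k] \<pi> Q by blast
  then show "fo_structure_over D (gamma (restrict D Q M) \<pi>)"
    using const[OF \<pi>] by (simp add: fo_structure_over_def restrict_simps)
next
  fix \<pi> \<pi>' c
  assume "\<pi> \<in> Q" "\<pi>' \<in> Q"
  then show "const_int (gamma M \<pi>) c = const_int (gamma M \<pi>') c"
    using const_int_rigid[OF M] Q by blast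
qed (use assms in auto)

lemma sat_restrict:
  assumes M: "standpoint_structure M" and D: "D \<subseteq> domain M"
    and const: "\<And>\<pi> c. \<pi> \<in> Q \<Longrightarrow> const_int (gamma M \<pi>) c \<in> D"
    and count: "\<And>\<pi> v \<phi> x cmp n. \<pi> \<in> Q \<Longrightarrow> range v \<subseteq> D \<Longrightarrow>
      compares cmp n ({d \<in> domain M. sat M \<pi> (v(x := d)) \<phi>} \<inter> D)
        = compares cmp n {d \<in> domain M. sat M \<pi> (v(x := d)) \<phi>}"
    and dia: "\<And>v e \<phi>. range v \<subseteq> D \<Longrightarrow> \<exists>\<pi>\<in>sexpr_int (sigma M) e. sat M \<pi> v \<phi> \<Longrightarrow>
      \<exists>\<pi>\<in>sexpr_int (sigma M) e \<inter> Q. sat M \<pi> v \<phi>"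
    and "\<pi> \<in> Q" "range v \<subseteq> D"
  shows "sat (restrict D Q M) \<pi> v \<phi> = sat M \<pi> v \<phi>"
  using assms(6,7)
proof (induction \<phi> arbitrary: \<pi> v)
  case (Pred p ts)
  have eq: "trm_int (gamma (restrict D Q M) \<pi>) v = trm_int (gamma M \<pi>) v"
  proof
    show "trm_int (gamma (restrict D Q M) \<pi>) v t = trm_int (gamma M \<pi>) v t" for t
      by (cases t) (auto simp: restrict_def)
  qed
  have "trm_int (gamma M \<pi>) v t \<in> D" for t
    using Pred.prems const by (cases t) auto
  then have "map (trm_int (gamma M \<pi>) v) ts \<in> lists D" by auto
  moreover have "pred_int (gamma (restrict D Q M) \<pi>) p k = pred_int (gamma M \<pi>) p k \<inter> lists D" for k
    by (simp add: restrict_def)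
  ultimately show ?case by (simp add: eq)
next
  case (Eq t u)
  have eq: "trm_int (gamma (restrict D Q M) \<pi>) v = trm_int (gamma M \<pi>) v"
  proof
    show "trm_int (gamma (restrict D Q M) \<pi>) v t = trm_int (gamma M \<pi>) v t" for t
      by (cases t) (auto simp: restrict_def)
  qed
  show ?case by (simp add: eq)
next
  case (Exists cmp n x \<phi>)
  have "sat (restrict D Q M) \<pi> (v(x := d)) \<phi> = sat M \<pi> (v(x := d)) \<phi>" if "d \<in> D" for d
    using Exists.prems that by (intro Exists.IH) auto
  then have "{d \<in> domain (restrict D Q M). sat (restrict D Q M) \<pi> (v(x := d)) \<phi>}
      = {d \<in> domain M. sat M \<pi> (v(x := d)) \<phi>} \<inter> D"
    using D by (auto simp: restrict_def)
  with count[OF Exists.prems] show ?case by simp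
next
  case (Dia e \<phi>)
  then show ?case using dia[OF Dia.prems(2), of e \<phi>]
    by (auto simp: sexpr_int_restrict)
qed auto

lemma ex_countable_witnesses:
  "\<exists>W'\<subseteq>W. countable W' \<and> (finite W \<longrightarrow> W' = W) \<and> (infinite W \<longrightarrow> infinite W')"
proof (cases "finite W")
  case True
  then show ?thesis by (auto intro: exI[of _ W] countable_finite)
next
  case False
  then show ?thesis using infinite_countable_subset'[of W] by blast
qed

lemma countable_elementary_substructure:
  fixes M :: "('d, 'p) standpoint_structure"
  assumes M: "standpoint_structure M"
  obtains D Q where "D \<subseteq> domain M" "Q \<subseteq> precs M" "countable D" "countable Q"
    and "standpoint_structure (restrict D Q M)"
    and "\<And>\<pi> v \<phi>. \<pi> \<in> Q \<Longrightarrow> range v \<subseteq> D \<Longrightarrow> sat (restrict D Q M) \<pi> v \<phi> = sat M \<pi> v \<phi>"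
proof -
  obtain d0 where d0: "d0 \<in> domain M" using standpoint_structureD(1)[OF M] by blast
  obtain \<pi>0 where \<pi>0: "\<pi>0 \<in> precs M" using standpoint_structureD(2)[OF M] by blast
  define asg where "asg ds = (\<lambda>i. if i < length ds then ds ! i else d0)" for ds :: "'d list"
  define W where "W \<pi> ds \<phi> x = {d \<in> domain M. sat M \<pi> ((asg ds)(x := d)) \<phi>}" for \<pi> ds \<phi> x
  obtain wit where wit: "wit \<pi> ds \<phi> x \<subseteq> W \<pi> ds \<phi> x" "countable (wit \<pi> ds \<phi> x)"
      "finite (W \<pi> ds \<phi> x) \<Longrightarrow> wit \<pi> ds \<phi> x = W \<pi> ds \<phi> x"
      "infinite (W \<pi> ds \<phi> x) \<Longrightarrow> infinite (wit \<pi> ds \<phi> x)" for \<pi> ds \<phi> x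
    using ex_countable_witnesses[of "W _ _ _ _"] by metis
  define P where "P ds e \<phi> \<pi> \<longleftrightarrow> \<pi> \<in> sexpr_int (sigma M) e \<and> sat M \<pi> (asg ds) \<phi>" for ds e \<phi> \<pi>
  define pw where "pw ds e \<phi> = (if \<exists>\<pi>. P ds e \<phi> \<pi> then SOME \<pi>. P ds e \<phi> \<pi> else \<pi>0)" for ds e \<phi>
  have pw: "P ds e \<phi> (pw ds e \<phi>)" if "P ds e \<phi> \<pi>" for ds e \<phi> \<pi>
    using that by (auto simp: pw_def intro: someI)
  have pw_prec: "pw ds e \<phi> \<in> precs M" for ds e \<phi>
  proof (cases "\<exists>\<pi>. P ds e \<phi> \<pi>")
    case True
    then have "P ds e \<phi> (pw ds e \<phi>)" using pw by blast
    then show ?thesis using sexpr_int_subset[OF M, of e] unfolding P_def by blast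
  next
    case False
    then show ?thesis using \<pi>0 by (simp add: pw_def)
  qed
  define F :: "'d set \<times> 'p set \<Rightarrow> 'd set \<times> 'p set" where
    "F = (\<lambda>(D, Q). (D \<union> (\<Union>\<pi>\<in>Q. \<Union>ds\<in>lists D. \<Union>\<phi>. \<Union>x. wit \<pi> ds \<phi> x),
                    Q \<union> (\<Union>ds\<in>lists D. \<Union>e. \<Union>\<phi>. {pw ds e \<phi>})))"
  define S where "S n = (F ^^ n) (insert d0 (range (const_int (gamma M \<pi>0))), {\<pi>0})" for n
  have S_Suc: "S (Suc n) = F (S n)" for n by (simp add: S_def)
  have const0: "const_int (gamma M \<pi>) c = const_int (gamma M \<pi>0) c" if "\<pi> \<in> precs M" for \<pi> c
    using const_int_rigid[OF M that \<pi>0] .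
  have S_sub: "fst (S n) \<subseteq> domain M \<and> snd (S n) \<subseteq> precs M \<and> countable (fst (S n)) \<and> countable (snd (S n))"
    for n
  proof (induction n)
    case 0
    then show ?case using d0 \<pi>0 standpoint_structureD(5)[OF M \<pi>0]
      by (auto simp: S_def)
  next
    case (Suc n)
    obtain D Q where DQ: "S n = (D, Q)" by (cases "S n")
    have "d \<in> domain M" if "d \<in> wit \<pi> ds \<phi> x" for d \<pi> ds \<phi> x
      using wit(1)[of \<pi> ds \<phi> x] that by (auto simp: W_def)
    moreover have "countable (lists D)" using Suc DQ by (simp add: countable_lists)
    ultimately show ?case using Suc DQ pw_prec wit(2)
      by (auto simp: S_Suc F_def intro!: countable_Un countable_UN)
  qed
  have S_mono1: "fst (S n) \<subseteq> fst (S (Suc n))" and S_mono2: "snd (S n) \<subseteq> snd (S (Suc n))" for n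
    by (auto simp: S_Suc F_def split: prod.splits)
  have mono1: "fst (S m) \<subseteq> fst (S n)" if "m \<le> n" for m n
    using lift_Suc_mono_le[of "\<lambda>n. fst (S n)", OF S_mono1 that] .
  have mono2: "snd (S m) \<subseteq> snd (S n)" if "m \<le> n" for m n
    using lift_Suc_mono_le[of "\<lambda>n. snd (S n)", OF S_mono2 that] .
  define D where "D = (\<Union>n. fst (S n))"
  define Q where "Q = (\<Union>n. snd (S n))"
  have D: "D \<subseteq> domain M" "countable D" and Q: "Q \<subseteq> precs M" "countable Q"
    using S_sub by (auto simp: D_def Q_def)
  have D0: "d0 \<in> D" "const_int (gamma M \<pi>0) c \<in> D" and Q0: "\<pi>0 \<in> Q" for c
    by (auto simp: D_def Q_def S_def intro!: exI[of _ 0])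
  have const: "const_int (gamma M \<pi>) c \<in> D" if "\<pi> \<in> Q" for \<pi> c
    using that Q(1) D0(2)[of c] const0[of \<pi> c] by (metis subsetD)
  have lists_D: "\<exists>n. ds \<in> lists (fst (S n))" if "set ds \<subseteq> D" for ds
    using that
  proof (induction ds)
    case (Cons d ds)
    then obtain m n where mn: "d \<in> fst (S m)" "ds \<in> lists (fst (S n))" by (auto simp: D_def)
    have "d \<in> fst (S (max m n))" "ds \<in> lists (fst (S (max m n)))"
      using mn mono1[of m "max m n"] lists_mono[OF mono1[of n "max m n"]] by auto
    then show ?case by (intro exI[of _ "max m n"]) auto
  qed auto
  have wit_D: "wit \<pi> ds \<phi> x \<subseteq> D" if \<pi>: "\<pi> \<in> Q" and ds: "set ds \<subseteq> D" for \<pi> ds \<phi> x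
  proof -
    obtain m where m: "\<pi> \<in> snd (S m)" using \<pi> by (auto simp: Q_def)
    obtain n where n: "ds \<in> lists (fst (S n))" using lists_D[OF ds] by auto
    define k where "k = max m n"
    have "\<pi> \<in> snd (S k)" "ds \<in> lists (fst (S k))"
      using m n mono2[of m k] lists_mono[OF mono1[of n k]] by (auto simp: k_def)
    then have "wit \<pi> ds \<phi> x \<subseteq> fst (S (Suc k))"
      unfolding S_Suc F_def by (cases "S k") (simp; blast)
    then show ?thesis by (auto simp: D_def)
  qed
  have pw_Q: "pw ds e \<phi> \<in> Q" if ds: "set ds \<subseteq> D" for ds e \<phi>
  proof -
    obtain k where "ds \<in> lists (fst (S k))" using lists_D[OF ds] by auto
    then have "pw ds e \<phi> \<in> snd (S (Suc k))"
      unfolding S_Suc F_def by (cases "S k") (simp; blast)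
    then show ?thesis by (auto simp: Q_def)
  qed
  have asg_ex: "\<exists>ds. set ds \<subseteq> D \<and> (\<forall>x\<in>fm_vars \<phi>. asg ds x = v x)"
    if v: "range v \<subseteq> D" for v \<phi>
  proof -
    obtain N where "\<forall>x\<in>fm_vars \<phi>. x < N"
      using finite_fm_vars[of \<phi>] finite_nat_set_iff_bounded by blast
    then show ?thesis using v
      by (intro exI[of _ "map v [0..<N]"]) (auto simp: asg_def)
  qed
  have count: "compares cmp n ({d \<in> domain M. sat M \<pi> (v(x := d)) \<phi>} \<inter> D)
        = compares cmp n {d \<in> domain M. sat M \<pi> (v(x := d)) \<phi>}"
    if \<pi>: "\<pi> \<in> Q" and v: "range v \<subseteq> D" for \<pi> v \<phi> x cmp n
  proof -
    obtain ds where ds: "set ds \<subseteq> D" "\<forall>x\<in>fm_vars \<phi>. asg ds x = v x" using asg_ex[OF v] by blast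
    have "sat M \<pi> (v(x := d)) \<phi> = sat M \<pi> ((asg ds)(x := d)) \<phi>" for d
      using ds(2) by (intro sat_cong) auto
    then have eq: "{d \<in> domain M. sat M \<pi> (v(x := d)) \<phi>} = W \<pi> ds \<phi> x" by (simp add: W_def)
    have sub: "wit \<pi> ds \<phi> x \<subseteq> W \<pi> ds \<phi> x \<inter> D" using wit(1) wit_D[OF \<pi> ds(1)] by blast
    show ?thesis
    proof (cases "finite (W \<pi> ds \<phi> x)")
      case True
      then have "W \<pi> ds \<phi> x \<inter> D = W \<pi> ds \<phi> x" using sub wit(3)[of \<pi> ds \<phi> x] by blast
      then show ?thesis by (simp add: eq)
    next
      case False
      then have "infinite (W \<pi> ds \<phi> x \<inter> D)" using sub wit(4)[of \<pi> ds \<phi> x] finite_subset by blast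
      with False show ?thesis by (cases cmp) (auto simp: eq)
    qed
  qed
  have dia: "\<exists>\<pi>\<in>sexpr_int (sigma M) e \<inter> Q. sat M \<pi> v \<phi>"
    if v: "range v \<subseteq> D" and ex: "\<exists>\<pi>\<in>sexpr_int (sigma M) e. sat M \<pi> v \<phi>" for v e \<phi>
  proof -
    obtain ds where ds: "set ds \<subseteq> D" "\<forall>x\<in>fm_vars \<phi>. asg ds x = v x" using asg_ex[OF v] by blast
    have eq: "sat M \<pi> (asg ds) \<phi> = sat M \<pi> v \<phi>" for \<pi>
      using ds(2) by (intro sat_cong) auto
    obtain \<pi> where "P ds e \<phi> \<pi>" using ex by (auto simp: P_def eq)
    from pw[OF this] show ?thesis using pw_Q[OF ds(1)] by (auto simp: P_def eq)
  qed
  show ?thesis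
  proof (rule that)
    show "standpoint_structure (restrict D Q M)"
      using D0(1) Q0 const by (intro restrict_structure[OF M Q(1)]) auto
    show "sat (restrict D Q M) \<pi> v \<phi> = sat M \<pi> v \<phi>" if "\<pi> \<in> Q" "range v \<subseteq> D" for \<pi> v \<phi>
      by (rule sat_restrict[OF M D(1) const count dia that])
  qed (use D Q in auto)
qed

theorem models_imp_satisfiable:
  fixes M :: "('d, 'p) standpoint_structure"
  assumes "models M \<phi>"
  shows "satisfiable \<phi>"
proof -
  have M: "standpoint_structure M" using assms by (simp add: models_def)
  obtain D Q where DQ: "D \<subseteq> domain M" "Q \<subseteq> precs M" "countable D" "countable Q"
    and R: "standpoint_structure (restrict D Q M)"
    and sat: "\<And>\<pi> v \<phi>. \<pi> \<in> Q \<Longrightarrow> range v \<subseteq> D \<Longrightarrow> sat (restrict D Q M) \<pi> v \<phi> = sat M \<pi> v \<phi>"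
    by (rule countable_elementary_substructure[OF M]) blast
  have [simp]: "domain (restrict D Q M) = D" "precs (restrict D Q M) = Q"
    by (simp_all add: restrict_def)
  have "models (restrict D Q M) \<phi>"
    unfolding models_def
  proof (intro conjI ballI allI impI)
    fix \<pi> and v :: "nat \<Rightarrow> 'd"
    assume "\<pi> \<in> precs (restrict D Q M)" and "range v \<subseteq> domain (restrict D Q M)"
    then have \<pi>: "\<pi> \<in> Q" and v: "range v \<subseteq> D" by simp_all
    have "sat M \<pi> v \<phi>"
      using assms \<pi> v DQ(1,2) unfolding models_def by blast
    then show "sat (restrict D Q M) \<pi> v \<phi>" using sat[OF \<pi> v] by simp
  qed (rule R)
  then have "models (transport (to_nat_on D) (to_nat_on Q) (restrict D Q M)) \<phi>"
    using DQ by (intro models_transport[OF R]) (simp_all add: inj_on_to_nat_on)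
  then show ?thesis by (auto simp: satisfiable_def)
qed

end

theory Submission
  imports Defs
begin

text \<open>
  A constant is replaced by a unary predicate required to hold possibly of exactly one element;
  since possibility does not depend on the precisification, the element so named is rigid, and
  this requirement mentions the predicate only once.  An atom with constants becomes an
  existential statement about variables not occurring in it, in which the names of the atom
  keep their order.  Hence the words can be rewritten by finite automata: a sweep to the right
  writes the requirements for all constant occurrences, a sweep to the left attaches to each
  atom the shapes of its terms, and another sweep to the right writes the translated formula.
\<close>

section \<open>Three-sweep transducers\<close>

text \<open>The obstacle is that names are binary words of unbounded length: a finite automaton can
  copy a name while reading it, but can neither store it nor compare it with another one. So each
  reading of a name yields at most one copy. A rigidity axiom that mentions the new predicate twice
  is therefore out of reach, and a constant that occurs several times gets its requirement several
  times. The shapes of the terms form a finite amount of information and can be carried. They are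
  needed early: in prefix notation the new quantifiers stand before the atom, while the choice of
  their variables depends on the terms behind it. This is why one sweep runs to the left. Two
  variables suffice because an atom has at most two terms, so every constant in it leaves a variable
  unoccupied; the new quantifiers enclose just this atom, and rebinding that variable disturbs
  nothing outside.\<close>

fun transduce :: "('s \<Rightarrow> 'a \<Rightarrow> 's \<times> 'b list) \<Rightarrow> 's \<Rightarrow> 'a list \<Rightarrow> 's \<times> 'b list" where
  "transduce f s [] = (s, [])"
| "transduce f s (a # as) =
     (let (s', w) = f s a; (s'', w') = transduce f s' as in (s'', w @ w'))"

lemma transduce_append:
  "transduce f s (as @ bs) =
     (let (s', w) = transduce f s as; (s'', w') = transduce f s' bs in (s'', w @ w'))"
  by (induction as arbitrary: s) (auto split: prod.splits)

text \<open>The state flows from right to left. Exactly one symbol per letter is produced, so a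
  machine can overwrite its input in place.\<close>

fun annotate :: "('s \<Rightarrow> 'a \<Rightarrow> 's \<times> 'b) \<Rightarrow> 's \<Rightarrow> 'a list \<Rightarrow> 's \<times> 'b list" where
  "annotate f s [] = (s, [])"
| "annotate f s (a # as) =
     (let (s', bs) = annotate f s as; (s'', b) = f s' a in (s'', b # bs))"

lemma annotate_append:
  "annotate f s (as @ bs) =
     (let (s', ys) = annotate f s bs; (s'', xs) = annotate f s' as in (s'', xs @ ys))"
  by (induction as) (auto split: prod.splits)

lemma length_annotate: "length (snd (annotate f s as)) = length as"
  by (induction as) (auto split: prod.splits)

datatype ('g, 'm, 'e) phase = Gather 'g | Mark 'm | Emit 'e | Done

instance phase :: (finite, finite, finite) finite
proof
  have "x \<in> range Gather \<union> range Mark \<union> range Emit \<union> {Done}" for x :: "('a, 'b, 'c) phase"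
    by (cases x) auto
  then have "(UNIV :: ('a, 'b, 'c) phase set) \<subseteq> range Gather \<union> range Mark \<union> range Emit \<union> {Done}"
    by blast
  then show "finite (UNIV :: ('a, 'b, 'c) phase set)" by (rule finite_subset) simp
qed

section \<open>Tape contents that mix letters and work symbols\<close>

definition cells :: "'a symbol list \<Rightarrow> int \<Rightarrow> 'a symbol" where
  "cells xs i = (if 0 \<le> i \<and> i < int (length xs) then xs ! nat i else Blank)"

lemma written_eq_cells: "written w = cells (map Letter w)"
  by (auto simp: written_def cells_def fun_eq_iff)

lemma cells_read: "cells (xs @ a # ys) (int (length xs)) = a"
  by (simp add: cells_def)

lemma cells_write: "(cells (xs @ a # ys))(int (length xs) := b) = cells (xs @ b # ys)"
  by (auto simp: cells_def fun_eq_iff nth_append nth_Cons')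

lemma cells_outside: "i < 0 \<or> int (length xs) \<le> i \<Longrightarrow> cells xs i = Blank"
  by (auto simp: cells_def)

lemma cells_write_outside: "i < 0 \<or> int (length xs) \<le> i \<Longrightarrow> (cells xs)(i := Blank) = cells xs"
  by (auto simp: cells_def fun_eq_iff)

lemma written_snoc: "(written w)(int (length w) := Letter a) = written (w @ [a])"
  by (auto simp: written_def fun_eq_iff nth_append)

lemma funpow_step_halted: "q = halt T \<Longrightarrow> (step T ^^ n) (q, ts) = (q, ts)"
  by (induction n) auto

locale three_sweeps =
  fixes gather :: "'g::finite \<Rightarrow> 'a::finite \<Rightarrow> 'g \<times> 'a list" and g0 :: 'g
    and mark :: "'m::finite \<Rightarrow> 'a \<Rightarrow> 'm \<times> 'b::finite" and m0 :: 'm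
    and emit :: "'e::finite \<Rightarrow> 'b \<Rightarrow> 'e \<times> 'a list" and e0 :: 'e
begin

definition result :: "'a list \<Rightarrow> 'a list" where
  "result w = snd (transduce gather g0 w) @ snd (transduce emit e0 (snd (annotate mark m0 w)))"

definition cell :: "'b \<Rightarrow> 'a symbol" where
  "cell b = Work (to_nat b)"

fun trans :: "('g, 'm, 'e) phase \<Rightarrow> 'a symbol \<Rightarrow>
    ('g, 'm, 'e) phase \<times> 'a symbol \<times> direction \<times> 'a list" where
  "trans (Gather g) (Letter a) =
     (case gather g a of (g', w) \<Rightarrow> (Gather g', Letter a, MoveRight, w))"
| "trans (Gather g) _ = (Mark m0, Blank, MoveLeft, [])"
| "trans (Mark m) (Letter a) = (case mark m a of (m', b) \<Rightarrow> (Mark m', cell b, MoveLeft, []))"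
| "trans (Mark m) _ = (Emit e0, Blank, MoveRight, [])"
| "trans (Emit e) (Work n) =
     (case emit e (from_nat n) of (e', w) \<Rightarrow> (Emit e', Work n, MoveRight, w))"
| "trans (Emit e) _ = (Done, Blank, Stay, [])"
| "trans Done a = (Done, a, Stay, [])"

text \<open>The vacuous equation makes the definition depend on the type of the marked letters.\<close>

definition syms :: "'a symbol set" where
  "syms = {Blank} \<union> range Letter \<union> {cell b | b r. r = emit e0 b}"

text \<open>Bounds the output of one transition and hence the words pending in states: the state set
  stays finite, and each symbol read costs at most \<open>Suc width\<close> steps.\<close>

definition width :: nat where
  "width = Max ((\<lambda>(s, a). length (snd (snd (snd (trans s a))))) ` (UNIV \<times> syms))"

text \<open>
  A state of the machine carries the word still to be written on the output tape; the input
  tape is only read when this word is empty.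
\<close>

definition machine :: "'a tm" where
  "machine = \<lparr>tapes = 2, states = to_nat ` ((UNIV :: ('g, 'm, 'e) phase set) \<times> {w :: 'a list. length w \<le> width}),
     start = to_nat (Gather g0 :: ('g, 'm, 'e) phase, [] :: 'a list),
     halt = to_nat (Done :: ('g, 'm, 'e) phase, [] :: 'a list),
     alphabet = syms,
     delta = (\<lambda>n as. case (from_nat n :: ('g, 'm, 'e) phase \<times> 'a list) of
        (s, c # w) \<Rightarrow> (to_nat (s, w), [(as ! 0, Stay), (Letter c, MoveRight)])
      | (s, []) \<Rightarrow> (case trans s (as ! 0) of
          (s', a, d, w) \<Rightarrow> (to_nat (s', w), [(a, d), (as ! 1, Stay)])))\<rparr>"

lemma finite_syms: "finite syms"
proof -
  have "syms = {Blank} \<union> range Letter \<union> range cell" by (auto simp: syms_def)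
  then show ?thesis by simp
qed

lemma width: "a \<in> syms \<Longrightarrow> trans s a = (s', b, d, w) \<Longrightarrow> length w \<le> width"
  unfolding width_def
  by (rule Max_ge) (simp_all add: finite_syms image_iff Bex_def split_beta, metis fst_conv snd_conv)

lemma trans_syms: "a \<in> syms \<Longrightarrow> trans s a = (s', b, d, w) \<Longrightarrow> b \<in> syms"
  by (cases "(s, a)" rule: trans.cases) (auto simp: syms_def split: prod.splits)

lemma turing_machine_machine: "turing_machine machine"
  unfolding turing_machine_def
proof (intro conjI ballI allI impI)
  show "finite (states machine)"
    using finite_lists_length_le[of "UNIV :: 'a set" width] by (simp add: machine_def)
  fix q and as :: "'a symbol list"
  assume "q \<in> states machine" and as: "length as = tapes machine \<and> set as \<subseteq> alphabet machine"
  then obtain s w where q: "q = to_nat (s :: ('g, 'm, 'e) phase, w :: 'a list)" "length w \<le> width"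
    by (auto simp: machine_def)
  have sy: "as ! 0 \<in> syms" "as ! 1 \<in> syms"
    using as by (auto simp: machine_def subset_iff)
  show "case delta machine q as of (q', acts) \<Rightarrow>
      q' \<in> states machine \<and> length acts = tapes machine \<and> fst ` set acts \<subseteq> alphabet machine"
  proof (cases w)
    case Nil
    then show ?thesis using sy width[OF sy(1)] trans_syms[OF sy(1)] q
      by (auto simp: machine_def split: prod.splits)
  next
    case (Cons c w')
    then show ?thesis using sy q by (auto simp: machine_def syms_def)
  qed
qed (auto simp: machine_def finite_syms, auto simp: syms_def)

section \<open>Runs of the machine and their length\<close>

definition conf :: "('g, 'm, 'e) phase \<Rightarrow> (int \<Rightarrow> 'a symbol) \<Rightarrow> int \<Rightarrow> 'a list \<Rightarrow> nat \<times> 'a tape list"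
  where "conf s f i u = (to_nat (s, [] :: 'a list), [(f, i), (written u, int (length u))])"

text \<open>An upper bound rather than an exact count, because the time of a transition varies with
  the length of the word that it writes.\<close>

definition reach :: "nat \<times> 'a tape list \<Rightarrow> nat \<Rightarrow> nat \<times> 'a tape list \<Rightarrow> bool" where
  "reach c n c' \<longleftrightarrow> (\<exists>k\<le>n. (step machine ^^ k) c = c')"

lemma reach_refl: "reach c 0 c"
  by (simp add: reach_def)

lemma reach_trans: "reach c m c' \<Longrightarrow> reach c' n c'' \<Longrightarrow> reach c (m + n) c''"
  unfolding reach_def
proof safe
  fix k l assume "k \<le> m" "l \<le> n"
  then show "\<exists>j\<le>m + n. (step machine ^^ j) c = (step machine ^^ l) ((step machine ^^ k) c)"
    by (intro exI[of _ "l + k"]) (simp add: funpow_add)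
qed

lemma flush:
  "(step machine ^^ length w) (to_nat (s, w), [(f, i), (written u, int (length u))])
     = conf s f i (u @ w)"
proof (induction w arbitrary: u)
  case (Cons c w)
  have "step machine (to_nat (s, c # w), [(f, i), (written u, int (length u))])
      = (to_nat (s, w), [(f, i), (written (u @ [c]), int (length (u @ [c])))])"
    by (simp add: machine_def written_snoc del: fun_upd_apply)
  then show ?case using Cons[of "u @ [c]"]
    by (simp add: funpow_Suc_right del: funpow.simps step.simps)
qed (simp add: conf_def)

lemma reach_trans_step:
  assumes "trans s (f i) = (s', a, d, w)" "s \<noteq> Done" "f i \<in> syms"
  shows "reach (conf s f i u) (Suc width) (conf s' (f(i := a)) (shift d i) (u @ w))"
proof -
  have "step machine (conf s f i u)
      = (to_nat (s', w), [(f(i := a), shift d i), (written u, int (length u))])"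
    using assms by (simp add: machine_def conf_def)
  then have "(step machine ^^ Suc (length w)) (conf s f i u)
      = conf s' (f(i := a)) (shift d i) (u @ w)"
    by (simp only: funpow_Suc_right o_apply flush)
  then show ?thesis
    using width[OF assms(3,1)] unfolding reach_def by (intro exI[of _ "Suc (length w)"]) simp
qed

lemma reach_gather:
  assumes "transduce gather g as = (g', w)"
  shows "reach (conf (Gather g) (cells (map Letter (l @ as))) (int (length l)) u)
    (length as * Suc width)
    (conf (Gather g') (cells (map Letter (l @ as))) (int (length (l @ as))) (u @ w))"
  using assms
proof (induction as arbitrary: l g u w)
  case (Cons a as)
  obtain g1 w1 where 1: "gather g a = (g1, w1)" by fastforce
  obtain w2 where 2: "transduce gather g1 as = (g', w2)" "w = w1 @ w2"
    using Cons.prems 1 by (auto split: prod.splits)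
  let ?f = "cells (map Letter (l @ a # as))"
  have f: "?f (int (length l)) = Letter a" "?f(int (length l) := Letter a) = ?f"
    using cells_read[of "map Letter l" "Letter a"] cells_write[of "map Letter l" "Letter a"]
    by simp_all
  have step: "reach (conf (Gather g) ?f (int (length l)) u) (Suc width)
      (conf (Gather g1) ?f (int (length (l @ [a]))) (u @ w1))"
    using reach_trans_step[of "Gather g" ?f "int (length l)" "Gather g1" "Letter a" MoveRight w1 u] 1 f
    by (simp add: syms_def add.commute)
  have "reach (conf (Gather g1) ?f (int (length (l @ [a]))) (u @ w1)) (length as * Suc width)
      (conf (Gather g') ?f (int (length (l @ a # as))) (u @ w))"
    using Cons.IH[OF 2(1), of "l @ [a]" "u @ w1"] by (simp add: 2)
  from reach_trans[OF step this] show ?case by (simp add: add.left_commute)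
qed (simp add: reach_refl)

text \<open>The head starts at the right end, so the induction removes the last letter;
  \<open>r\<close> holds the cells already marked.\<close>

lemma reach_mark:
  assumes "annotate mark m as = (m', bs)"
  shows "reach (conf (Mark m) (cells (map Letter as @ r)) (int (length as) - 1) u)
    (length as * Suc width)
    (conf (Mark m') (cells (map cell bs @ r)) (- 1) u)"
  using assms
proof (induction as arbitrary: m r bs rule: rev_induct)
  case (snoc a as)
  obtain m1 b where 1: "mark m a = (m1, b)" by fastforce
  obtain bs' where 2: "annotate mark m1 as = (m', bs')" "bs = bs' @ [b]"
    using snoc.prems 1 by (auto simp: annotate_append split: prod.splits)
  let ?f = "cells (map Letter as @ Letter a # r)"
  have f: "?f (int (length as)) = Letter a"
      "?f(int (length as) := cell b) = cells (map Letter as @ cell b # r)"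
    using cells_read[of "map Letter as" "Letter a"] cells_write[of "map Letter as" "Letter a"]
    by simp_all
  have step: "reach (conf (Mark m) ?f (int (length as)) u) (Suc width)
      (conf (Mark m1) (cells (map Letter as @ cell b # r)) (int (length as) - 1) u)"
    using reach_trans_step[of "Mark m" ?f "int (length as)" "Mark m1" "cell b" MoveLeft "[]" u] 1 f
    by (simp add: syms_def)
  from reach_trans[OF step snoc.IH[OF 2(1)]]
  show ?case by (simp add: 2 add.left_commute)
qed (simp add: reach_refl)

lemma reach_emit:
  assumes "transduce emit e bs = (e', w)"
  shows "reach (conf (Emit e) (cells (map cell (l @ bs))) (int (length l)) u)
    (length bs * Suc width)
    (conf (Emit e') (cells (map cell (l @ bs))) (int (length (l @ bs))) (u @ w))"
  using assms
proof (induction bs arbitrary: l e u w)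
  case (Cons b bs)
  obtain e1 w1 where 1: "emit e b = (e1, w1)" by fastforce
  obtain w2 where 2: "transduce emit e1 bs = (e', w2)" "w = w1 @ w2"
    using Cons.prems 1 by (auto split: prod.splits)
  let ?f = "cells (map cell (l @ b # bs))"
  have f: "?f (int (length l)) = cell b" "?f(int (length l) := cell b) = ?f"
    using cells_read[of "map cell l" "cell b"] cells_write[of "map cell l" "cell b"]
    by simp_all
  have step: "reach (conf (Emit e) ?f (int (length l)) u) (Suc width)
      (conf (Emit e1) ?f (int (length (l @ [b]))) (u @ w1))"
    using reach_trans_step[of "Emit e" ?f "int (length l)" "Emit e1" "cell b" MoveRight w1 u] 1 f
    by (simp add: syms_def add.commute cell_def)
  have "reach (conf (Emit e1) ?f (int (length (l @ [b]))) (u @ w1)) (length bs * Suc width)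
      (conf (Emit e') ?f (int (length (l @ b # bs))) (u @ w))"
    using Cons.IH[OF 2(1), of "l @ [b]" "u @ w1"] by (simp add: 2)
  from reach_trans[OF step this] show ?case by (simp add: add.left_commute)
qed (simp add: reach_refl)

text \<open>Each of the three sweeps reads \<open>length w\<close> letters and the blank that ends
  it, which makes \<open>3 * length w + 3\<close> transitions.\<close>

lemma reach_result:
  "\<exists>f i. reach (conf (Gather g0) (written w) 0 []) ((3 * length w + 3) * Suc width)
     (conf Done f i (result w))"
proof -
  obtain g1 u where 1: "transduce gather g0 w = (g1, u)" by fastforce
  obtain m1 bs where 2: "annotate mark m0 w = (m1, bs)" by fastforce
  obtain e1 u' where 3: "transduce emit e0 bs = (e1, u')" by fastforce
  have len: "length bs = length w" using length_annotate[of mark m0 w] 2 by simp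
  let ?f = "cells (map Letter w)" and ?h = "cells (map cell bs)" and ?n = "int (length w)"
  note blank = cells_outside cells_write_outside syms_def
  have "reach (conf (Gather g0) (written w) 0 []) (length w * Suc width) (conf (Gather g1) ?f ?n u)"
    using reach_gather[OF 1, of "[]" "[]"] by (simp add: written_eq_cells)
  also have "reach (conf (Gather g1) ?f ?n u) (Suc width) (conf (Mark m0) ?f (?n - 1) u)"
    using reach_trans_step[of "Gather g1" ?f ?n "Mark m0" Blank MoveLeft "[]" u]
    by (simp add: blank)
  also (reach_trans) have "reach (conf (Mark m0) ?f (?n - 1) u) (length w * Suc width)
      (conf (Mark m1) ?h (- 1) u)"
    using reach_mark[OF 2, of "[]" u] by simp
  also (reach_trans) have "reach (conf (Mark m1) ?h (- 1) u) (Suc width) (conf (Emit e0) ?h 0 u)"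
    using reach_trans_step[of "Mark m1" ?h "- 1" "Emit e0" Blank MoveRight "[]" u]
    by (simp add: blank)
  also (reach_trans) have "reach (conf (Emit e0) ?h 0 u) (length w * Suc width)
      (conf (Emit e1) ?h ?n (u @ u'))"
    using reach_emit[OF 3, of "[]" u] by (simp add: len)
  also (reach_trans) have "reach (conf (Emit e1) ?h ?n (u @ u')) (Suc width)
      (conf Done ?h ?n (u @ u'))"
    using reach_trans_step[of "Emit e1" ?h ?n Done Blank Stay "[]" "u @ u'"]
    by (simp add: blank len)
  finally (reach_trans) show ?thesis
    by (intro exI[of _ ?h] exI[of _ ?n]) (simp add: result_def 1 2 3 numeral_3_eq_3 algebra_simps)
qed

lemma outputs_within_result:
  "outputs_within machine (poly [:3 * Suc width, 3 * Suc width:] (length w)) w (result w)"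
proof -
  obtain f i k where k: "k \<le> (3 * length w + 3) * Suc width"
    "(step machine ^^ k) (conf (Gather g0) (written w) 0 []) = conf Done f i (result w)"
    using reach_result[of w] unfolding reach_def by blast
  define n where "n = poly [:3 * Suc width, 3 * Suc width:] (length w)"
  \<comment> \<open>The run may halt early; a halted configuration is fixed by \<open>step\<close>,
    so it survives the remaining \<open>n - k\<close> steps.\<close>
  have "(n - k) + k = n" using k(1) by (simp add: n_def algebra_simps)
  then have "(step machine ^^ n) (conf (Gather g0) (written w) 0 [])
      = (step machine ^^ (n - k)) (conf Done f i (result w))"
    using k(2) funpow_add[of "n - k" k "step machine"] by simp
  also have "\<dots> = conf Done f i (result w)"
    unfolding conf_def by (rule funpow_step_halted) (simp add: machine_def)
  finally have "(step machine ^^ n) (conf (Gather g0) (written w) 0 []) = conf Done f i (result w)" .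
  moreover have "initial machine w = conf (Gather g0) (written w) 0 []"
    by (simp add: initial_def conf_def machine_def)
  moreover have "halt machine = to_nat (Done :: ('g, 'm, 'e) phase, [] :: 'a list)"
    by (simp add: machine_def)
  ultimately have "outputs_within machine n w (result w)"
    by (simp add: outputs_within_def conf_def)
  then show ?thesis by (simp only: n_def)
qed

theorem polytime_on_result:
  fixes enc :: "'x \<Rightarrow> 'a list"
  assumes "\<And>x. x \<in> X \<Longrightarrow> enc (f x) = result (enc x)"
  shows "polytime_on enc X f"
  unfolding polytime_on_def
  using turing_machine_machine outputs_within_result[of "enc _"] assms
  by (intro exI[of _ machine] exI[of _ "[:3 * Suc width, 3 * Suc width:]"]) (metis (no_types))

end

section \<open>Eliminating constants\<close>

text \<open>
  The names \<open>4 * c + 2\<close> for constants and \<open>2 * p + 1\<close> for the old predicates are chosen such that,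
  in binary, fixed bits are prepended to \<open>c\<close> and \<open>p\<close>.
\<close>

definition is_const :: "nat \<Rightarrow> nat \<Rightarrow> fm" where
  "is_const c x = Dia (ESym Star) (Pred (4 * c + 2) [Var x])"

definition unique_const :: "nat \<Rightarrow> fm" where
  "unique_const c = Exists Exactly 1 0 (is_const c 0)"

fun trm_const_list :: "trm \<Rightarrow> nat list" where
  "trm_const_list (Var x) = []"
| "trm_const_list (Const c) = [c]"

fun const_list :: "fm \<Rightarrow> nat list" where
  "const_list (Pred p ts) = concat (map trm_const_list ts)"
| "const_list (Eq t u) = trm_const_list t @ trm_const_list u"
| "const_list (Neg \<phi>) = const_list \<phi>"
| "const_list (Conj \<phi> \<psi>) = const_list \<phi> @ const_list \<psi>"
| "const_list (Exists cmp n x \<phi>) = const_list \<phi>"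
| "const_list (Dia e \<phi>) = const_list \<phi>"

text \<open>
  The shape of a term is \<open>None\<close> for a constant and \<open>Some b\<close> for the variable \<open>of_bool b\<close>.
  In the list \<open>vars ks\<close>, the constants of an atom are replaced by variables which do not occur
  in it.
\<close>

fun kind :: "trm \<Rightarrow> bool option" where
  "kind (Var x) = Some (x \<noteq> 0)"
| "kind (Const c) = None"

fun vars :: "bool option list \<Rightarrow> bool list" where
  "vars [Some a] = [a]"
| "vars [None] = [False]"
| "vars [Some a, Some b] = [a, b]"
| "vars [Some a, None] = [a, \<not> a]"
| "vars [None, Some b] = [\<not> b, b]"
| "vars [None, None] = [False, True]"
| "vars _ = []"

text \<open>Instructions for the third sweep, with the options reversed against \<open>kind\<close>:
  \<open>None\<close> deletes a variable term, and \<open>Some b\<close> turns a constant into a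
  conjunct about the variable \<open>of_bool b\<close>.\<close>

definition script :: "bool option list \<Rightarrow> bool option list" where
  "script ks = map2 (\<lambda>k b. if k = None then Some b else None) ks (vars ks)"

abbreviation bvar :: "bool \<Rightarrow> trm" where
  "bvar b \<equiv> Var (of_bool b)"

fun const_slots :: "trm list \<Rightarrow> bool list \<Rightarrow> (nat \<times> bool) list" where
  "const_slots (Const c # ts) (b # bs) = (c, b) # const_slots ts bs"
| "const_slots (Var x # ts) (b # bs) = const_slots ts bs"
| "const_slots _ _ = []"

text \<open>The conjunction nests to the left so that, in prefix notation, all its connectives
  precede the atom and the conjuncts naming the constants follow it.\<close>

definition bind :: "(nat \<times> bool) list \<Rightarrow> fm \<Rightarrow> fm" where
  "bind cs \<psi> = foldr (\<lambda>(c, b). Exists AtLeast 1 (of_bool b)) cs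
     (foldl (\<lambda>\<psi> (c, b). Conj \<psi> (is_const c (of_bool b))) \<psi> cs)"

fun elim_const :: "fm \<Rightarrow> fm" where
  "elim_const (Pred p ts) = (let bs = vars (map kind ts) in
     bind (const_slots ts bs) (Pred (2 * p + 1) (map bvar bs)))"
| "elim_const (Eq t u) = (let bs = vars [kind t, kind u] in
     bind (const_slots [t, u] bs) (Eq (bvar (bs ! 0)) (bvar (bs ! 1))))"
| "elim_const (Neg \<phi>) = Neg (elim_const \<phi>)"
| "elim_const (Conj \<phi> \<psi>) = Conj (elim_const \<phi>) (elim_const \<psi>)"
| "elim_const (Exists cmp n x \<phi>) = Exists cmp n x (elim_const \<phi>)"
| "elim_const (Dia e \<phi>) = Dia e (elim_const \<phi>)"

text \<open>With conjunctions nested to the right, the word of the whole formula is the output of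
  the first sweep followed by that of the third.\<close>

definition CF :: "fm \<Rightarrow> fm" where
  "CF \<phi> = foldr (\<lambda>c. Conj (unique_const c)) (const_list \<phi>) (elim_const \<phi>)"

lemma set_trm_const_list: "set (trm_const_list t) = trm_consts t"
  by (cases t) auto

lemma set_const_list: "set (const_list \<phi>) = fm_consts \<phi>"
  by (induction \<phi>) (auto simp: set_trm_const_list)

text \<open>A recursive form of \<open>C2\<close>, which passes to subformulae in
  inductions.\<close>

fun small :: "fm \<Rightarrow> bool" where
  "small (Pred p ts) \<longleftrightarrow> length ts \<le> 2 \<and> (\<forall>t\<in>set ts. trm_vars t \<subseteq> {0, 1})"
| "small (Eq t u) \<longleftrightarrow> trm_vars t \<union> trm_vars u \<subseteq> {0, 1}"
| "small (Neg \<phi>) \<longleftrightarrow> small \<phi>"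
| "small (Conj \<phi> \<psi>) \<longleftrightarrow> small \<phi> \<and> small \<psi>"
| "small (Exists cmp n x \<phi>) \<longleftrightarrow> x \<in> {0, 1} \<and> small \<phi>"
| "small (Dia e \<phi>) \<longleftrightarrow> small \<phi>"

lemma C2_iff_small: "C2 \<phi> \<longleftrightarrow> small \<phi>"
  by (induction \<phi>) (auto simp: C2_def)

lemma small_trm_cases:
  assumes "trm_vars t \<subseteq> {0, 1}"
  obtains "t = Var 0" | "t = Var 1" | c where "t = Const c"
  using assms by (cases t) auto

lemma list_le2_cases:
  assumes "length xs \<le> 2"
  obtains "xs = []" | x where "xs = [x]" | x y where "xs = [x, y]"
proof (cases xs)
  case (Cons x ys)
  then show ?thesis using assms that(2,3) by (cases ys) auto
qed (use that(1) in auto)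

section \<open>The syntactic fragments under the translation\<close>

lemma length_vars: "length ks \<le> 2 \<Longrightarrow> length (vars ks) = length ks"
  by (induction ks rule: vars.induct) auto

lemma fm_vars_bind:
  "fm_vars (bind cs \<psi>) = fm_vars \<psi> \<union> (\<lambda>(c, b). of_bool b) ` set cs"
proof -
  have "fm_vars (foldl (\<lambda>\<psi> (c, b). Conj \<psi> (is_const c (of_bool b))) \<psi> cs)
      = fm_vars \<psi> \<union> (\<lambda>(c, b). of_bool b) ` set cs"
    by (induction cs arbitrary: \<psi>) (auto simp: is_const_def)
  moreover have "fm_vars (foldr (\<lambda>(c, b). Exists AtLeast 1 (of_bool b)) cs \<chi>)
      = (\<lambda>(c, b). of_bool b) ` set cs \<union> fm_vars \<chi>" for \<chi>
    by (induction cs) (simp_all add: split_beta)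
  ultimately show ?thesis by (auto simp: bind_def)
qed

lemma fm_consts_bind: "fm_consts (bind cs \<psi>) = fm_consts \<psi>"
proof -
  have "fm_consts (foldl (\<lambda>\<psi> (c, b). Conj \<psi> (is_const c (of_bool b))) \<psi> cs) = fm_consts \<psi>"
    by (induction cs arbitrary: \<psi>) (auto simp: is_const_def)
  moreover have "fm_consts (foldr (\<lambda>(c, b). Exists AtLeast 1 (of_bool b)) cs \<chi>) = fm_consts \<chi>" for \<chi>
    by (induction cs) (simp_all add: split_beta)
  ultimately show ?thesis by (auto simp: bind_def)
qed

lemma fm_preds_bind: "fm_preds (bind cs \<psi>) = fm_preds \<psi> \<union> (\<lambda>(c, b). (4 * c + 2, 1)) ` set cs"
proof -
  have "fm_preds (foldl (\<lambda>\<psi> (c, b). Conj \<psi> (is_const c (of_bool b))) \<psi> cs)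
      = fm_preds \<psi> \<union> (\<lambda>(c, b). (4 * c + 2, 1)) ` set cs"
    by (induction cs arbitrary: \<psi>) (auto simp: is_const_def)
  moreover have "fm_preds (foldr (\<lambda>(c, b). Exists AtLeast 1 (of_bool b)) cs \<chi>) = fm_preds \<chi>" for \<chi>
    by (induction cs) (simp_all add: split_beta)
  ultimately show ?thesis by (auto simp: bind_def)
qed

lemma fm_sexprs_bind: "fm_sexprs (bind cs \<psi>) \<subseteq> insert (ESym Star) (fm_sexprs \<psi>)"
proof -
  have "fm_sexprs (foldl (\<lambda>\<psi> (c, b). Conj \<psi> (is_const c (of_bool b))) \<psi> cs)
      \<subseteq> insert (ESym Star) (fm_sexprs \<psi>)"
    by (induction cs arbitrary: \<psi>) (fastforce simp: is_const_def)+
  moreover have "fm_sexprs (foldr (\<lambda>(c, b). Exists AtLeast 1 (of_bool b)) cs \<chi>) = fm_sexprs \<chi>" for \<chi>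
    by (induction cs) (simp_all add: split_beta)
  ultimately show ?thesis by (auto simp: bind_def)
qed

lemma fm_vars_elim_const: "small \<phi> \<Longrightarrow> fm_vars (elim_const \<phi>) \<subseteq> {0, 1}"
  by (induction \<phi>) (auto simp: Let_def fm_vars_bind)

lemma fm_consts_elim_const: "fm_consts (elim_const \<phi>) = {}"
  by (induction \<phi>) (auto simp: Let_def fm_consts_bind)

text \<open>New predicates are unary, and replacing constants by variables keeps the length of an
  argument list. This serves both the bound 2 on arities and the absence of nullary
  predicates.\<close>

lemma arity_elim_const:
  assumes "small \<phi>" "(q, k) \<in> fm_preds (elim_const \<phi>)"
  shows "k = 1 \<or> (\<exists>p. (p, k) \<in> fm_preds \<phi>)"
  using assms by (induction \<phi>) (auto simp: Let_def fm_preds_bind length_vars)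

lemma fm_sexprs_elim_const: "fm_sexprs (elim_const \<phi>) \<subseteq> insert (ESym Star) (fm_sexprs \<phi>)"
  by (induction \<phi>) (use fm_sexprs_bind in \<open>fastforce simp: Let_def\<close>)+

lemma fm_vars_CF: "small \<phi> \<Longrightarrow> fm_vars (CF \<phi>) \<subseteq> {0, 1}"
proof -
  have "fm_vars (foldr (\<lambda>c. Conj (unique_const c)) cs \<psi>) \<subseteq> {0} \<union> fm_vars \<psi>" for cs \<psi>
    by (induction cs) (auto simp: unique_const_def is_const_def)
  then show ?thesis if "small \<phi>" using fm_vars_elim_const[OF that] unfolding CF_def by blast
qed

lemma fm_consts_CF: "fm_consts (CF \<phi>) = {}"
proof -
  have "fm_consts (foldr (\<lambda>c. Conj (unique_const c)) cs \<psi>) = fm_consts \<psi>" for cs \<psi>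
    by (induction cs) (auto simp: unique_const_def is_const_def)
  then show ?thesis by (simp add: CF_def fm_consts_elim_const)
qed

lemma arity_CF:
  assumes "small \<phi>" "(q, k) \<in> fm_preds (CF \<phi>)"
  shows "k = 1 \<or> (\<exists>p. (p, k) \<in> fm_preds \<phi>)"
proof -
  have "(q, k) \<in> fm_preds (foldr (\<lambda>c. Conj (unique_const c)) cs \<psi>) \<Longrightarrow> k = 1 \<or> (q, k) \<in> fm_preds \<psi>"
    for cs \<psi>
    by (induction cs) (auto simp: unique_const_def is_const_def)
  then show ?thesis using assms arity_elim_const unfolding CF_def by blast
qed

lemma fm_sexprs_CF: "fm_sexprs (CF \<phi>) \<subseteq> insert (ESym Star) (fm_sexprs \<phi>)"
proof -
  have "fm_sexprs (foldr (\<lambda>c. Conj (unique_const c)) cs \<psi>) \<subseteq> insert (ESym Star) (fm_sexprs \<psi>)" for cs \<psi>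
    by (induction cs) (auto simp: unique_const_def is_const_def)
  then show ?thesis using fm_sexprs_elim_const unfolding CF_def by blast
qed

section \<open>Equisatisfiability\<close>

definition named :: "('d, 'p) standpoint_structure \<Rightarrow> nat \<Rightarrow> 'd \<Rightarrow> bool" where
  "named N c d \<longleftrightarrow> (\<exists>\<pi>\<in>precs N. [d] \<in> pred_int (gamma N \<pi>) (4 * c + 2) 1)"

lemma sat_is_const:
  assumes "sigma N Star = precs N"
  shows "sat N \<pi> v (is_const c x) \<longleftrightarrow> named N c (v x)"
  using assms by (simp add: is_const_def named_def)

lemma sat_unique_const:
  assumes "sigma N Star = precs N"
  shows "sat N \<pi> v (unique_const c) \<longleftrightarrow> (\<exists>!d. d \<in> domain N \<and> named N c d)"
proof -
  have "sat N \<pi> v (unique_const c) \<longleftrightarrow> card {d \<in> domain N. named N c d} = 1"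
    by (auto simp: unique_const_def sat_is_const[OF assms] intro: card_ge_0_finite)
  also have "\<dots> \<longleftrightarrow> (\<exists>!d. d \<in> domain N \<and> named N c d)"
    by (simp add: card_1_singleton_iff set_eq_iff) metis
  finally show ?thesis .
qed

lemma compares_AtLeast_1: "compares AtLeast (Suc 0) W \<longleftrightarrow> W \<noteq> {}"
  by (cases "finite W") (auto simp: Suc_le_eq card_gt_0_iff)

lemma sat_Exists_AtLeast_1:
  "sat N \<pi> v (Exists AtLeast (Suc 0) x \<psi>) \<longleftrightarrow> (\<exists>d\<in>domain N. sat N \<pi> (v(x := d)) \<psi>)"
  unfolding sat.simps compares_AtLeast_1 by auto

fun assign :: "(nat \<Rightarrow> 'd) \<Rightarrow> (nat \<times> bool) list \<Rightarrow> (nat \<Rightarrow> 'd) \<Rightarrow> nat \<Rightarrow> 'd" where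
  "assign I [] v = v"
| "assign I ((c, b) # cs) v = assign I cs (v(of_bool b := I c))"

text \<open>Each quantifier has \<open>I c\<close> as its only admissible witness and so acts like
  an assignment. Distinct variables prevent the inner quantifier from overwriting the value chosen
  by the outer one.\<close>

lemma sat_bind:
  assumes N: "sigma N Star = precs N"
    and I: "\<And>c b. (c, b) \<in> set cs \<Longrightarrow> I c \<in> domain N"
    and named: "\<And>c b d. (c, b) \<in> set cs \<Longrightarrow> d \<in> domain N \<Longrightarrow> named N c d \<longleftrightarrow> d = I c"
    and cs: "distinct (map snd cs)"
  shows "sat N \<pi> v (bind cs \<psi>) \<longleftrightarrow> sat N \<pi> (assign I cs v) \<psi>"
proof -
  have conj: "sat N \<pi> v (foldl (\<lambda>\<psi> (c, b). Conj \<psi> (is_const c (of_bool b))) \<psi> ds)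
      \<longleftrightarrow> sat N \<pi> v \<psi> \<and> (\<forall>(c, b)\<in>set ds. named N c (v (of_bool b)))" for v \<psi> ds
    by (induction ds arbitrary: \<psi>) (auto simp: sat_is_const[OF N])
  \<comment> \<open>There are only two Boolean labels, so a list with distinct labels has at most
    two entries.\<close>
  have "length cs \<le> 2"
  proof -
    have "card (set (map snd cs)) \<le> card (UNIV :: bool set)" by (intro card_mono) auto
    then show ?thesis using distinct_card[OF cs] by simp
  qed
  then show ?thesis
  proof (cases rule: list_le2_cases)
    case (2 x)
    then show ?thesis using I named
      by (cases x)
        (auto simp: bind_def conj sat_is_const[OF N] sat_Exists_AtLeast_1 simp del: sat.simps(5))
  next
    case (3 x y)
    obtain c b d e where [simp]: "x = (c, b)" "y = (d, e)" by fastforce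
    have "of_bool b \<noteq> (of_bool e :: nat)" using cs 3 by (cases b; cases e) auto
    moreover have "named N c z \<longleftrightarrow> z = I c" "named N d z \<longleftrightarrow> z = I d" if "z \<in> domain N" for z
      using named[of c b z] named[of d e z] 3 that by auto
    moreover have "I c \<in> domain N" "I d \<in> domain N" using I[of c b] I[of d e] 3 by auto
    ultimately show ?thesis using 3
      by (auto simp: bind_def conj sat_is_const[OF N] sat_Exists_AtLeast_1 simp del: sat.simps(5))
  qed (simp add: bind_def)
qed

lemma distinct_const_slots:
  "length ts \<le> 2 \<Longrightarrow> distinct (map snd (const_slots ts (vars (map kind ts))))"
proof (erule list_le2_cases)
  show "distinct (map snd (const_slots ts (vars (map kind ts))))" if "ts = [t, u]" for t u
    using that by (cases t; cases u) auto
  show "distinct (map snd (const_slots ts (vars (map kind ts))))" if "ts = [t]" for t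
    using that by (cases t) auto
qed simp

lemma const_slots_subset: "(c, b) \<in> set (const_slots ts bs) \<Longrightarrow> Const c \<in> set ts"
  by (induction ts bs rule: const_slots.induct) auto

text \<open>Constants receive variables that the atom does not use, so the values of its own
  variables survive the update. \<open>J\<close> evaluates variables only, which allows
  \<open>I\<close> and \<open>J\<close> to come from different models.\<close>

lemma assign_const_slots:
  assumes "length ts \<le> 2" "\<forall>t\<in>set ts. trm_vars t \<subseteq> {0, 1}"
  shows "map (trm_int J (assign (const_int I) (const_slots ts (vars (map kind ts))) v) \<circ> bvar)
      (vars (map kind ts)) = map (trm_int I v) ts"
  using assms(1)
proof (cases rule: list_le2_cases)
  case (2 t)
  then have "trm_vars t \<subseteq> {0, 1}" using assms by simp
  then show ?thesis by (rule small_trm_cases) (use 2 in auto)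
next
  case (3 t u)
  then have "trm_vars t \<subseteq> {0, 1}" "trm_vars u \<subseteq> {0, 1}" using assms by simp_all
  then show ?thesis
    by (elim small_trm_cases) (use 3 in auto)
qed simp

text \<open>One relation for both directions of equisatisfiability, whether \<open>N\<close> is
  built from \<open>M\<close> or \<open>M\<close> from \<open>N\<close>. The set \<open>C\<close> is
  there because a model of the translation fixes the denotations only of constants that
  occur.\<close>

definition represents :: "('d, 'p) standpoint_structure \<Rightarrow> nat set \<Rightarrow> ('d, 'p) standpoint_structure \<Rightarrow> bool"
  where "represents N C M \<longleftrightarrow>
     domain N = domain M \<and> precs N = precs M \<and> sigma N = sigma M \<and>
     (\<forall>\<pi>\<in>precs M. \<forall>p k. pred_int (gamma N \<pi>) (2 * p + 1) k = pred_int (gamma M \<pi>) p k) \<and>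
     (\<forall>\<pi>\<in>precs M. \<forall>c\<in>C. \<forall>d\<in>domain M. named N c d \<longleftrightarrow> d = const_int (gamma M \<pi>) c)"

lemma sat_elim_const:
  assumes M: "standpoint_structure M"
    and "represents N (fm_consts \<phi>) M" "small \<phi>" "\<pi> \<in> precs M"
  shows "sat N \<pi> v (elim_const \<phi>) \<longleftrightarrow> sat M \<pi> v \<phi>"
  using assms(2-)
proof (induction \<phi> arbitrary: \<pi> v)
  case (Pred p ts)
  let ?bs = "vars (map kind ts)"
  have "sat N \<pi> v (elim_const (Pred p ts))
      \<longleftrightarrow> sat N \<pi> (assign (const_int (gamma M \<pi>)) (const_slots ts ?bs) v) (Pred (2 * p + 1) (map bvar ?bs))"
    unfolding elim_const.simps Let_def
  proof (rule sat_bind)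
    show "sigma N Star = precs N" using Pred.prems(1) standpoint_structureD(4)[OF M]
      by (simp add: represents_def)
    show "const_int (gamma M \<pi>) c \<in> domain N" for c
      using Pred.prems standpoint_structureD(5)[OF M] by (simp add: represents_def)
    show "named N c d \<longleftrightarrow> d = const_int (gamma M \<pi>) c"
      if "(c, b) \<in> set (const_slots ts ?bs)" "d \<in> domain N" for c b d
      using that Pred.prems const_slots_subset[OF that(1)] by (force simp: represents_def)
  qed (use Pred.prems in \<open>simp add: distinct_const_slots\<close>)
  also have "\<dots> \<longleftrightarrow> sat M \<pi> v (Pred p ts)"
    using Pred.prems assign_const_slots[of ts "gamma N \<pi>" "gamma M \<pi>" v]
    by (simp add: represents_def length_vars)
  finally show ?case .
next
  case (Eq t u)
  let ?bs = "vars [kind t, kind u]"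
  have "sat N \<pi> v (elim_const (Eq t u))
      \<longleftrightarrow> sat N \<pi> (assign (const_int (gamma M \<pi>)) (const_slots [t, u] ?bs) v)
        (Eq (bvar (?bs ! 0)) (bvar (?bs ! 1)))"
    unfolding elim_const.simps Let_def
  proof (rule sat_bind)
    show "sigma N Star = precs N" using Eq.prems(1) standpoint_structureD(4)[OF M]
      by (simp add: represents_def)
    show "const_int (gamma M \<pi>) c \<in> domain N" for c
      using Eq.prems standpoint_structureD(5)[OF M] by (simp add: represents_def)
    show "named N c d \<longleftrightarrow> d = const_int (gamma M \<pi>) c"
      if "(c, b) \<in> set (const_slots [t, u] ?bs)" "d \<in> domain N" for c b d
      using that Eq.prems const_slots_subset[OF that(1)] by (auto simp: represents_def)
    show "distinct (map snd (const_slots [t, u] ?bs))"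
      using distinct_const_slots[of "[t, u]"] by simp
  qed
  also have "\<dots> \<longleftrightarrow> sat M \<pi> v (Eq t u)"
  proof -
    obtain a b where bs: "?bs = [a, b]"
      using length_vars[of "[kind t, kind u]"] by (auto simp: length_Suc_conv numeral_2_eq_2)
    show ?thesis
      using Eq.prems assign_const_slots[of "[t, u]" "gamma N \<pi>" "gamma M \<pi>" v] by (simp add: bs)
  qed
  finally show ?case .
next
  case (Dia e \<phi>)
  have "sexpr_int (sigma M) e \<subseteq> precs M" by (rule sexpr_int_subset[OF M])
  moreover have "sigma N = sigma M" using Dia.prems by (simp add: represents_def)
  ultimately show ?case using Dia by auto
next
  case (Exists cmp n x \<phi>)
  then show ?case by (simp add: represents_def)
next
  case (Conj \<phi> \<psi>)
  then have "represents N (fm_consts \<phi>) M" "represents N (fm_consts \<psi>) M"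
    by (auto simp: represents_def)
  then show ?case using Conj by simp
qed simp

lemma sat_CF:
  assumes M: "standpoint_structure M" and N: "represents N (fm_consts \<phi>) M"
    and "small \<phi>" "\<pi> \<in> precs M"
  shows "sat N \<pi> v (CF \<phi>) \<longleftrightarrow> sat M \<pi> v \<phi>"
proof -
  have star: "sigma N Star = precs N"
    using N standpoint_structureD(4)[OF M] by (simp add: represents_def)
  have "sat N \<pi> v (unique_const c)" if "c \<in> fm_consts \<phi>" for c
  proof -
    have "d \<in> domain N \<and> named N c d \<longleftrightarrow> d = const_int (gamma M \<pi>) c" for d
      using N that assms(4) standpoint_structureD(5)[OF M assms(4)]
      unfolding represents_def by metis
    then show ?thesis by (simp add: sat_unique_const[OF star])
  qed
  moreover have "sat N \<pi> v (foldr (\<lambda>c. Conj (unique_const c)) cs \<psi>)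
      \<longleftrightarrow> (\<forall>c\<in>set cs. sat N \<pi> v (unique_const c)) \<and> sat N \<pi> v \<psi>" for cs \<psi>
    by (induction cs) auto
  ultimately show ?thesis
    using sat_elim_const[OF assms] by (simp add: CF_def set_const_list)
qed

lemma satisfiable_CF:
  assumes "small \<phi>" "satisfiable \<phi>"
  shows "satisfiable (CF \<phi>)"
proof -
  obtain M :: "(nat, nat) standpoint_structure" where mod: "models M \<phi>"
    using assms(2) by (auto simp: satisfiable_def)
  then have M: "standpoint_structure M" by (simp add: models_def)
  \<comment> \<open>The names are decoded by \<open>(2 * p + 1) div 2 = p\<close> and
    \<open>(4 * c + 2) div 4 = c\<close>. Since constants are rigid in \<open>M\<close>, every
    precisification contributes the same element to the predicate of \<open>c\<close>.\<close>
  define N where "N = M\<lparr>gamma := \<lambda>\<pi>. \<lparr>const_int = const_int (gamma M \<pi>),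
    pred_int = (\<lambda>q k. if odd q then pred_int (gamma M \<pi>) (q div 2) k
      else if k = 1 then {[const_int (gamma M \<pi>) (q div 4)]} else {})\<rparr>\<rparr>"
  have N: "standpoint_structure N"
    unfolding standpoint_structure_def
  proof (intro conjI allI ballI)
    show "const_int (gamma N \<pi>) c = const_int (gamma N \<pi>') c"
      if "\<pi> \<in> precs N" "\<pi>' \<in> precs N" for \<pi> \<pi>' c
      using const_int_rigid[OF M, of \<pi> \<pi>'] that by (simp add: N_def)
    show "fo_structure_over (domain N) (gamma N \<pi>)" if "\<pi> \<in> precs N" for \<pi>
      using standpoint_structureD(5,6)[OF M, of \<pi>] that
      by (simp add: fo_structure_over_def N_def)
  qed (use standpoint_structureD[OF M] in \<open>simp_all add: N_def\<close>)
  have [simp]: "Suc (Suc (4 * c)) div 4 = c" for c by presburger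
  have named: "named N c d \<longleftrightarrow> d = const_int (gamma M \<pi>) c" if "\<pi> \<in> precs M" for c d \<pi>
  proof
    assume "named N c d"
    then obtain \<pi>' where "\<pi>' \<in> precs M" "d = const_int (gamma M \<pi>') c"
      by (auto simp: named_def N_def)
    then show "d = const_int (gamma M \<pi>) c" using const_int_rigid[OF M _ that] by simp
  next
    assume "d = const_int (gamma M \<pi>) c"
    with that show "named N c d" by (auto simp: named_def N_def)
  qed
  have "represents N (fm_consts \<phi>) M"
    unfolding represents_def using named by (simp add: N_def)
  from sat_CF[OF M this assms(1)] have "models N (CF \<phi>)"
    using mod N by (simp add: models_def) (simp add: N_def)
  then show ?thesis by (auto simp: satisfiable_def)
qed

lemma satisfiable_of_CF:
  assumes "small \<phi>" "satisfiable (CF \<phi>)"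
  shows "satisfiable \<phi>"
proof -
  obtain N :: "(nat, nat) standpoint_structure" where mod: "models N (CF \<phi>)"
    using assms(2) by (auto simp: satisfiable_def)
  then have N: "standpoint_structure N" by (simp add: models_def)
  note star = standpoint_structureD(4)[OF N]
  obtain d0 \<pi>0 where 0: "d0 \<in> domain N" "\<pi>0 \<in> precs N" using standpoint_structureD(1,2)[OF N] by blast
  \<comment> \<open>One precisification and one assignment are enough, since the truth of
    \<open>unique_const c\<close> depends on neither.\<close>
  have "range (\<lambda>_ :: nat. d0) \<subseteq> domain N" using 0 by auto
  then have "sat N \<pi>0 (\<lambda>_. d0) (CF \<phi>)" using mod 0 unfolding models_def by blast
  moreover have "sat N \<pi>0 v (foldr (\<lambda>c. Conj (unique_const c)) cs \<psi>)
      \<Longrightarrow> c \<in> set cs \<Longrightarrow> sat N \<pi>0 v (unique_const c)" for v c cs \<psi>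
    by (induction cs) auto
  ultimately have ex1: "\<exists>!d. d \<in> domain N \<and> named N c d" if "c \<in> fm_consts \<phi>" for c
    using that unfolding CF_def sat_unique_const[OF star, symmetric, of c \<pi>0 "\<lambda>_. d0"]
      set_const_list[symmetric] by blast
  \<comment> \<open>A structure interprets all constants in its domain; \<open>d0\<close> serves
    those without a unique named element. As \<open>I\<close> does not mention a precisification,
    rigidity is immediate.\<close>
  define I where "I c = (if \<exists>!d. d \<in> domain N \<and> named N c d
    then THE d. d \<in> domain N \<and> named N c d else d0)" for c
  have I_dom: "I c \<in> domain N" for c
    using theI'[of "\<lambda>d. d \<in> domain N \<and> named N c d"] 0(1) by (simp add: I_def)
  have I: "named N c d \<longleftrightarrow> d = I c" if "c \<in> fm_consts \<phi>" "d \<in> domain N" for c d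
    using theI'[OF ex1[OF that(1)]] ex1[OF that(1)] that(2) unfolding I_def by auto
  define M where "M = N\<lparr>gamma := \<lambda>\<pi>. \<lparr>const_int = I,
    pred_int = (\<lambda>p k. pred_int (gamma N \<pi>) (2 * p + 1) k)\<rparr>\<rparr>"
  have M: "standpoint_structure M"
    unfolding standpoint_structure_def
  proof (intro conjI allI ballI)
    show "fo_structure_over (domain M) (gamma M \<pi>)" if "\<pi> \<in> precs M" for \<pi>
      using standpoint_structureD(6)[OF N, of \<pi>] that I_dom
      by (simp add: fo_structure_over_def M_def)
  qed (use standpoint_structureD[OF N] in \<open>simp_all add: M_def\<close>)
  have "represents N (fm_consts \<phi>) M"
    unfolding represents_def using I by (simp add: M_def)
  from sat_CF[OF M this assms(1)] have "models M \<phi>"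
    using mod M by (simp add: models_def) (simp add: M_def)
  then show ?thesis by (auto simp: satisfiable_def)
qed

section \<open>Computing the translation in three sweeps\<close>

lemma bits_odd: "bits (2 * p + 1) = Bit1 # bits p"
  by (subst bits.simps) simp

text \<open>The name \<open>2 * c\<close> would not do: zero is the empty word, so
  \<open>Bit0\<close> would not be prepended for \<open>c = 0\<close>. The extra \<open>Bit1\<close>
  keeps the number positive.\<close>

lemma bits_const_name: "bits (4 * c + 2) = Bit0 # Bit1 # bits c"
proof -
  have "(4 * c + 2) div 2 = 2 * c + 1" by simp
  then show ?thesis using bits_odd[of c] by (subst bits.simps) simp
qed

lemma set_bits: "set (bits n) \<subseteq> {Bit0, Bit1}"
proof (induction n rule: bits.induct)
  case (1 n)
  then show ?case by (cases "n = 0") (auto simp: bits.simps[of n] bits.simps[of 0])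
qed

lemma encode_is_const:
  "encode_fm (is_const c x)
     = [LDia, LStar, LPred, Bit0, Bit1] @ bits c @ Stop # encode_trm (Var x) @ [Stop]"
  using bits_const_name[of c] by (simp add: is_const_def encode_nat_def)

text \<open>All that precedes the atom is determined by the variables alone; the names of the
  constants come after it in their original order.\<close>

lemma encode_bind:
  "encode_fm (bind cs \<psi>) =
     concat (map (\<lambda>b. LAtLeast # encode_nat 1 @ encode_nat (of_bool b)) (map snd cs))
     @ replicate (length cs) LConj @ encode_fm \<psi>
     @ concat (map (\<lambda>(c, b). encode_fm (is_const c (of_bool b))) cs)"
proof -
  have "encode_fm (foldl (\<lambda>\<psi> (c, b). Conj \<psi> (is_const c (of_bool b))) \<psi> cs)
      = replicate (length cs) LConj @ encode_fm \<psi>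
        @ concat (map (\<lambda>(c, b). encode_fm (is_const c (of_bool b))) cs)"
    by (induction cs arbitrary: \<psi>) (auto simp: replicate_app_Cons_same)
  moreover have "encode_fm (foldr (\<lambda>(c, b). Exists AtLeast 1 (of_bool b)) cs \<chi>)
      = concat (map (\<lambda>b. LAtLeast # encode_nat 1 @ encode_nat (of_bool b)) (map snd cs))
        @ encode_fm \<chi>" for \<chi>
    by (induction cs) (simp_all add: split_beta)
  ultimately show ?thesis by (simp add: bind_def)
qed

instance letter :: finite
proof
  have "x \<in> {Bit0, Bit1, Stop, LVar, LConst, LPred, LEq, LNeg, LConj, LAtMost, LExactly, LAtLeast,
      LDia, LStar, LStandpoint, LInter, LUnion, LDiff}" if "x \<in> UNIV" for x
    by (cases x) simp_all
  then show "finite (UNIV :: letter set)" by (rule finite_subset[OF subsetI]) simp_all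
qed

text \<open>The states of the sweeps must form finite types, so lists of length at most 2 will not do.\<close>

datatype slots = Slots0 | Slots1 "bool option" | Slots2 "bool option" "bool option"

fun to_slots :: "bool option list \<Rightarrow> slots" where
  "to_slots [] = Slots0"
| "to_slots [a] = Slots1 a"
| "to_slots (a # b # _) = Slots2 a b"

fun of_slots :: "slots \<Rightarrow> bool option list" where
  "of_slots Slots0 = []"
| "of_slots (Slots1 a) = [a]"
| "of_slots (Slots2 a b) = [a, b]"

lemma of_slots_to_slots: "length ks \<le> 2 \<Longrightarrow> of_slots (to_slots ks) = ks"
  by (erule list_le2_cases) auto

instance slots :: finite
proof
  have "x \<in> {Slots0} \<union> range Slots1 \<union> range (\<lambda>(a, b). Slots2 a b)" if "x \<in> UNIV" for x
    by (cases x) auto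
  then show "finite (UNIV :: slots set)" by (rule finite_subset[OF subsetI]) simp_all
qed

datatype marked = Plain letter | Atom bool slots

instance marked :: finite
proof
  have "x \<in> range Plain \<union> range (\<lambda>(p, s). Atom p s)" if "x \<in> UNIV" for x
    by (cases x) auto
  then show "finite (UNIV :: marked set)" by (rule finite_subset[OF subsetI]) simp_all
qed

text \<open>\<open>Name\<close> keeps the shapes, needed to write the new arguments;
  \<open>Terms\<close> and \<open>InTerm\<close> keep the rest of the script, between and inside
  terms. The Boolean marks predicate atoms, which end with a \<open>Stop\<close> of their own,
  whereas an equation ends with its second term.\<close>

datatype emit_state = Copy | Name slots | Terms bool slots | InTerm bool slots

instance emit_state :: finite
proof
  have "x \<in> {Copy} \<union> range Name \<union> range (\<lambda>(p, s). Terms p s) \<union> range (\<lambda>(p, s). InTerm p s)" if "x \<in> UNIV" for x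
    by (cases x) auto
  then show "finite (UNIV :: emit_state set)" by (rule finite_subset[OF subsetI]) simp_all
qed

text \<open>The state of the first sweep tells whether the head is in the name of a constant.\<close>

fun gather_step :: "bool \<Rightarrow> letter \<Rightarrow> bool \<times> letter list" where
  "gather_step False a = (if a = LConst
     then (True, LConj # LExactly # encode_nat 1 @ encode_nat 0 @ [LDia, LStar, LPred, Bit0, Bit1])
     else (False, []))"
| "gather_step True a = (if a = Stop
     then (False, Stop # encode_trm (Var 0) @ [Stop])
     else (True, [a]))"

text \<open>
  The second sweep, from right to left, attaches to every atom the shapes of its terms.  Its
  state tells whether \<open>Bit1\<close> occurred since the last \<open>Stop\<close> and collects the shapes.
\<close>

fun mark_step :: "bool \<times> slots \<Rightarrow> letter \<Rightarrow> (bool \<times> slots) \<times> marked" where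
  "mark_step (b, s) Bit0 = ((b, s), Plain Bit0)"
| "mark_step (b, s) Bit1 = ((True, s), Plain Bit1)"
| "mark_step (b, s) Stop = ((False, s), Plain Stop)"
| "mark_step (b, s) LVar = ((False, to_slots (Some b # of_slots s)), Plain LVar)"
| "mark_step (b, s) LConst = ((False, to_slots (None # of_slots s)), Plain LConst)"
| "mark_step (b, s) LPred = ((False, Slots0), Atom True s)"
| "mark_step (b, s) LEq = ((False, Slots0), Atom False s)"
| "mark_step (b, s) a = ((False, Slots0), Plain a)"

text \<open>
  The variables to be quantified and the atom itself are thus known to the third sweep when it
  reaches the atom; the names of the predicate and of the constants are copied as they come.
\<close>

definition fresh :: "bool option list \<Rightarrow> bool list" where
  "fresh ks = concat (map (\<lambda>z. case z of None \<Rightarrow> [] | Some b \<Rightarrow> [b]) (script ks))"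

text \<open>An equation contains no predicate name and is written at once. For a predicate,
  \<open>Bit1\<close> is the lowest bit of \<open>2 * p + 1\<close>, and the bits of
  \<open>p\<close> are still to be copied.\<close>

definition atom_prefix :: "bool \<Rightarrow> bool option list \<Rightarrow> letter list" where
  "atom_prefix p ks =
     concat (map (\<lambda>b. LAtLeast # encode_nat 1 @ encode_nat (of_bool b)) (fresh ks))
     @ replicate (length (fresh ks)) LConj
     @ (if p then [LPred, Bit1] else LEq # concat (map (\<lambda>b. encode_trm (bvar b)) (vars ks)))"

fun emit_step :: "emit_state \<Rightarrow> marked \<Rightarrow> emit_state \<times> letter list" where
  "emit_step Copy (Plain a) = (Copy, [a])"
| "emit_step (Name s) (Plain a) = (if a = Stop
     then (Terms True (to_slots (script (of_slots s))),
       Stop # concat (map (\<lambda>b. encode_trm (bvar b)) (vars (of_slots s))) @ [Stop])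
     else (Name s, [a]))"
| "emit_step (Terms p s) (Plain a) = (if a = Stop then (Copy, [])
     else (InTerm p s, if a = LConst then [LDia, LStar, LPred, Bit0, Bit1] else []))"
| "emit_step (InTerm p s) (Plain a) = (case of_slots s of [] \<Rightarrow> (Copy, []) | z # zs \<Rightarrow>
     if a = Stop
     then (if p \<or> zs \<noteq> [] then Terms p (to_slots zs) else Copy,
       case z of None \<Rightarrow> [] | Some b \<Rightarrow> Stop # encode_trm (bvar b) @ [Stop])
     else (InTerm p s, if z = None then [] else [a]))"
| "emit_step _ (Atom p s) =
     (if p then Name s else Terms False (to_slots (script (of_slots s))), atom_prefix p (of_slots s))"

fun encode_marked :: "fm \<Rightarrow> marked list" where
  "encode_marked (Pred p ts) = Atom True (to_slots (map kind ts))
     # map Plain (encode_nat p @ concat (map encode_trm ts) @ [Stop])"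
| "encode_marked (Eq t u) = Atom False (to_slots [kind t, kind u])
     # map Plain (encode_trm t @ encode_trm u)"
| "encode_marked (Neg \<phi>) = Plain LNeg # encode_marked \<phi>"
| "encode_marked (Conj \<phi> \<psi>) = Plain LConj # encode_marked \<phi> @ encode_marked \<psi>"
| "encode_marked (Exists cmp n x \<phi>) =
     map Plain (encode_comparison cmp # encode_nat n @ encode_nat x) @ encode_marked \<phi>"
| "encode_marked (Dia e \<phi>) = map Plain (LDia # encode_sexpr e) @ encode_marked \<phi>"

subsection \<open>The first sweep\<close>

lemma transduce_gather_outside:
  "LConst \<notin> set w \<Longrightarrow> transduce gather_step False w = (False, [])"
  by (induction w) auto

lemma transduce_gather_inside:
  "Stop \<notin> set w \<Longrightarrow> transduce gather_step True w = (True, w)"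
  by (induction w) auto

lemma LConst_notin_encode_nat: "LConst \<notin> set (encode_nat n)"
  using set_bits[of n] by (auto simp: encode_nat_def)

lemma LConst_notin_encode_sexpr: "LConst \<notin> set (encode_sexpr e)"
  using LConst_notin_encode_nat by (induction e rule: encode_sexpr.induct) auto

abbreviation encode_unique :: "nat \<Rightarrow> letter list" where
  "encode_unique c \<equiv> LConj # encode_fm (unique_const c)"

lemma transduce_gather_trm:
  "transduce gather_step False (encode_trm t) = (False, concat (map encode_unique (trm_const_list t)))"
proof (cases t)
  case (Const c)
  have "Stop \<notin> set (bits c)" using set_bits[of c] by auto
  with Const show ?thesis
    by (simp add: encode_nat_def[of c] transduce_append transduce_gather_inside unique_const_def
        encode_is_const)
qed (simp add: transduce_gather_outside LConst_notin_encode_nat)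

lemma transduce_gather_trms:
  "transduce gather_step False (concat (map encode_trm ts))
     = (False, concat (map encode_unique (concat (map trm_const_list ts))))"
  by (induction ts) (auto simp: transduce_append transduce_gather_trm)

lemma transduce_gather:
  "transduce gather_step False (encode_fm \<phi>) = (False, concat (map encode_unique (const_list \<phi>)))"
proof (induction \<phi>)
  case (Exists cmp n x \<phi>)
  have "encode_comparison cmp \<noteq> LConst" by (cases cmp) auto
  with Exists show ?case
    by (simp add: transduce_append transduce_gather_outside LConst_notin_encode_nat)
qed (simp_all add: transduce_append transduce_gather_outside LConst_notin_encode_nat
    LConst_notin_encode_sexpr transduce_gather_trm transduce_gather_trms)

subsection \<open>The second sweep\<close>

lemma annotate_bits:
  "annotate mark_step (b, s) (bits n) = ((b \<or> n \<noteq> 0, s), map Plain (bits n))"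
proof (induction n rule: bits.induct)
  case (1 n)
  show ?case
  proof (cases "n = 0")
    case False
    then have "n div 2 \<noteq> 0 \<or> odd n" by presburger
    with False 1[OF False] show ?thesis by (auto simp: bits.simps[of n])
  qed (simp add: bits.simps)
qed

lemma annotate_nat:
  "annotate mark_step (b, s) (encode_nat n) = ((n \<noteq> 0, s), map Plain (encode_nat n))"
  by (simp add: encode_nat_def annotate_append annotate_bits)

lemma annotate_trm:
  "annotate mark_step (b, s) (encode_trm t)
     = ((False, to_slots (kind t # of_slots s)), map Plain (encode_trm t))"
  by (cases t) (simp_all add: annotate_nat)

lemma annotate_trms:
  assumes "length ts \<le> 2"
  shows "\<exists>b'. annotate mark_step (b, Slots0) (concat (map encode_trm ts))
     = ((b', to_slots (map kind ts)), map Plain (concat (map encode_trm ts)))"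
  using assms by (rule list_le2_cases) (auto simp: annotate_append annotate_trm)

lemma annotate_sexpr:
  "annotate mark_step (b, Slots0) (encode_sexpr e) = ((False, Slots0), map Plain (encode_sexpr e))"
  by (induction e arbitrary: b rule: encode_sexpr.induct)
    (simp_all add: annotate_append annotate_nat)

text \<open>The first letter of a formula, read last, resets the collected shapes, so they cannot
  leak into a formula further left.\<close>

lemma annotate_fm:
  "small \<phi> \<Longrightarrow> annotate mark_step (b, Slots0) (encode_fm \<phi>) = ((False, Slots0), encode_marked \<phi>)"
proof (induction \<phi> arbitrary: b)
  case (Pred p ts)
  then have "length ts \<le> 2" by simp
  from annotate_trms[OF this, of False] obtain b' where "annotate mark_step (False, Slots0) (concat (map encode_trm ts))
     = ((b', to_slots (map kind ts)), map Plain (concat (map encode_trm ts)))"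
    by blast
  then show ?case by (simp add: annotate_append annotate_nat)
next
  case (Exists cmp n x \<phi>)
  then show ?case by (cases cmp) (simp_all add: annotate_append annotate_nat)
qed (simp_all add: annotate_append annotate_trm annotate_sexpr)

subsection \<open>The third sweep\<close>

lemma transduce_copy: "transduce emit_step Copy (map Plain w) = (Copy, w)"
  by (induction w) auto

lemma transduce_name:
  "Stop \<notin> set w \<Longrightarrow> transduce emit_step (Name s) (map Plain w) = (Name s, w)"
  by (induction w) auto

lemma transduce_in_term:
  assumes "Stop \<notin> set w" "of_slots s = z # zs"
  shows "transduce emit_step (InTerm p s) (map Plain w) = (InTerm p s, if z = None then [] else w)"
  using assms by (induction w) auto

lemma Stop_notin_bits: "Stop \<notin> set (bits n)"
  using set_bits[of n] by auto

definition after_term :: "bool \<Rightarrow> bool option list \<Rightarrow> emit_state" where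
  "after_term p zs = (if p \<or> zs \<noteq> [] then Terms p (to_slots zs) else Copy)"

lemma transduce_var:
  assumes "of_slots s \<noteq> []" "hd (of_slots s) = None"
  shows "transduce emit_step (Terms p s) (map Plain (encode_trm (Var x)))
    = (after_term p (tl (of_slots s)), [])"
proof -
  have "of_slots s = None # tl (of_slots s)" using assms by (cases "of_slots s") auto
  from transduce_in_term[OF Stop_notin_bits this] this show ?thesis
    by (cases "of_slots s") (simp_all add: encode_nat_def transduce_append after_term_def)
qed

lemma transduce_const:
  assumes "of_slots s \<noteq> []" "hd (of_slots s) \<noteq> None"
  shows "transduce emit_step (Terms p s) (map Plain (encode_trm (Const c)))
    = (after_term p (tl (of_slots s)), encode_fm (is_const c (of_bool (the (hd (of_slots s))))))"
proof -
  obtain b where b: "of_slots s = Some b # tl (of_slots s)"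
    using assms by (cases "of_slots s") auto
  have "hd (of_slots s) = Some b" by (subst b) simp
  with transduce_in_term[OF Stop_notin_bits b] b show ?thesis
    by (cases "of_slots s")
      (simp_all add: encode_nat_def[of c] transduce_append after_term_def encode_is_const)
qed

lemma transduce_trms:
  assumes "length ts \<le> 2" "ts \<noteq> []"
  shows "transduce emit_step (Terms p (to_slots (script (map kind ts))))
      (map Plain (concat (map encode_trm ts)))
    = (after_term p [], concat (map (\<lambda>(c, b). encode_fm (is_const c (of_bool b)))
        (const_slots ts (vars (map kind ts)))))"
  using assms(1)
proof (cases rule: list_le2_cases)
  case (2 t)
  then show ?thesis
    by (cases t) (simp_all add: script_def transduce_var transduce_const del: encode_trm.simps)
next
  case (3 t u)
  then show ?thesis
    by (cases t; cases u)
      (simp_all add: script_def transduce_append transduce_var transduce_const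
        after_term_def[of _ "[_]"] del: encode_trm.simps)
qed (use assms in simp)

text \<open>The quantified variables depend on the shapes only and not on the names of the
  constants, so the third sweep can announce them before any constant is read.\<close>

lemma fresh_kinds:
  assumes "length ts \<le> 2"
  shows "fresh (map kind ts) = map snd (const_slots ts (vars (map kind ts)))"
  using assms
proof (cases rule: list_le2_cases)
  case (2 t)
  then show ?thesis by (cases t) (simp_all add: fresh_def script_def)
next
  case (3 t u)
  then show ?thesis by (cases t; cases u) (simp_all add: fresh_def script_def)
qed (simp add: fresh_def script_def)

lemma transduce_emit:
  "small \<phi> \<Longrightarrow> transduce emit_step Copy (encode_marked \<phi>) = (Copy, encode_fm (elim_const \<phi>))"
proof (induction \<phi>)
  case (Pred p ts)
  then have len: "length ts \<le> 2" by simp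
  have slots: "of_slots (to_slots (map kind ts)) = map kind ts"
    using len by (simp add: of_slots_to_slots)
  have terms: "transduce emit_step (Terms True (to_slots (script (map kind ts))))
      (map Plain (concat (map encode_trm ts)) @ [Plain Stop])
    = (Copy, concat (map (\<lambda>(c, b). encode_fm (is_const c (of_bool b)))
        (const_slots ts (vars (map kind ts)))))"
  \<comment> \<open>In a nullary atom the closing \<open>Stop\<close> follows the name directly,
    with no term to rewrite.\<close>
  proof (cases "ts = []")
    case False
    then show ?thesis
      by (simp only: transduce_append transduce_trms[OF len False]) (simp add: after_term_def)
  qed simp
  have "bits (Suc (2 * p)) = Bit1 # bits p" using bits_odd[of p] by simp
  with terms show ?case
    using fresh_kinds[OF len]
    by (simp add: Let_def encode_bind encode_nat_def[of p] encode_nat_def[of "Suc (2 * p)"]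
        transduce_append transduce_name Stop_notin_bits slots atom_prefix_def comp_def
        del: encode_trm.simps)
next
  case (Eq t u)
  have slots: "of_slots (to_slots [kind t, kind u]) = [kind t, kind u]" by simp
  obtain a b where bs: "vars [kind t, kind u] = [a, b]"
    using length_vars[of "[kind t, kind u]"] by (auto simp: length_Suc_conv numeral_2_eq_2)
  show ?case
    using transduce_trms[of "[t, u]" False] fresh_kinds[of "[t, u]"]
    by (simp add: Let_def encode_bind bs after_term_def atom_prefix_def del: encode_trm.simps)
next
  case (Exists cmp n x \<phi>)
  then show ?case by (simp add: transduce_append transduce_copy)
next
  case (Dia e \<phi>)
  then show ?case by (simp add: transduce_append transduce_copy)
qed (simp_all add: transduce_append)

text \<open>The restriction to \<open>small\<close> formulae reflects that the slots of the second
  sweep hold at most two terms.\<close>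

lemma encode_CF:
  assumes "small \<phi>"
  shows "encode_fm (CF \<phi>)
    = three_sweeps.result gather_step False mark_step (False, Slots0) emit_step Copy (encode_fm \<phi>)"
proof -
  have "encode_fm (foldr (\<lambda>c. Conj (unique_const c)) cs \<psi>)
      = concat (map encode_unique cs) @ encode_fm \<psi>" for cs \<psi>
    by (induction cs) auto
  then show ?thesis
    by (simp add: CF_def three_sweeps.result_def transduce_gather annotate_fm[OF assms]
        transduce_emit[OF assms])
qed

theorem theorem3:
  shows "\<exists>CF :: fm \<Rightarrow> fm.
    polytime_on encode_fm {\<phi>. C2 \<phi>} CF \<and>
    (\<forall>\<phi>. C2 \<phi> \<longrightarrow>
       C2 (CF \<phi>) \<and> constant_free (CF \<phi>) \<and> equisatisfiable (CF \<phi>) \<phi> \<and>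
       (S5 \<phi> \<and> nullary_free \<phi> \<longrightarrow> S5 (CF \<phi>) \<and> nullary_free (CF \<phi>)))"
proof (intro exI conjI allI impI)
  show "polytime_on encode_fm {\<phi>. C2 \<phi>} CF"
    by (rule three_sweeps.polytime_on_result) (simp add: encode_CF C2_iff_small)
  fix \<phi>
  assume C2: "C2 \<phi>"
  then have small: "small \<phi>" by (simp add: C2_iff_small)
  show "C2 (CF \<phi>)"
    using fm_vars_CF[OF small] arity_CF[OF small] C2 unfolding C2_def by fastforce
  show "constant_free (CF \<phi>)"
    by (simp add: constant_free_def fm_consts_CF)
  show "equisatisfiable (CF \<phi>) \<phi>"
    using satisfiable_CF[OF small] satisfiable_of_CF[OF small] by (auto simp: equisatisfiable_def)
  assume "S5 \<phi> \<and> nullary_free \<phi>"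
  then show "S5 (CF \<phi>)" "nullary_free (CF \<phi>)"
    using fm_sexprs_CF[of \<phi>] arity_CF[OF small] unfolding S5_def nullary_free_def by fastforce+
qed

end
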